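(* Let $\Gamma=\mathbb{Z}_2*\mathbb{Z}_2*\mathbb{Z}_2*\mathbb{Z}_2$, let $G$ be a $4$-colored graph with vertex set $X$, and let $\Phi$ be the induced action of $\Gamma$ on $X$. If $G$ is generic and of dense holonomy (that is, $\Phi$ is a generic action of dense holonomy), then the type space $X_G$ is homeomorphic to the Cantor set and the associated topological action $\widetilde{\Phi}$ of $\Gamma$ on $X_G$ is minimal.
   Context: A $4$-colored graph is an infinite connected graph $G$ whose edges are colored by the symbols $A,B,C,D$ so that edges incident to a common vertex have different colors. Let $A,B,C,D$ also denote the order-two generators of the four free factors of $\Gamma$. The induced action $\Phi$ of $\Gamma$ on the vertex set $X$ is defined on a generator $s\in\{A,B,C,D\}$ by $\Phi(s)(x)=y$ if there is an edge $(x,y)$ colored $s$, and $\Phi(s)(x)=x$ if no edge at $x$ is colored $s$. For an integer $r\ge 1$ and $x\in X$, the rooted $r$-ball $B_r(x)$ is the induced (spanned) subgraph of $G$ on the vertices $y$ with $d_G(x,y)\le r$ ($d_G$ the shortest path metric), with root $x$ and the induced edge-coloring. Two rooted $r$-balls are equivalent if there is a graph isomorphism between them preserving edge colors and mapping root to root. $U^r_G$ is the (finite) set of equivalence classes of rooted $r$-balls of $G$, and the $r$-type $\alpha_r(x)\in U^r_G$ of $x$ is the class of $B_r(x)$. For $\alpha\in U^r_G$ and $\beta\in U^{s}_G$ with $s>r$, write $\alpha\prec\beta$ if the $r$-ball around the root of $\beta$ is of class $\alpha$. $G$ is of dense holonomy if for every $r\ge1$ and every $\alpha\in U^r_G$ there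 is an integer $m_\alpha$ such that every ball of radius $m_\alpha$ in $G$ contains at least one vertex $x$ with $\alpha_r(x)=\alpha$. $G$ is generic if for any two distinct vertices $x\neq y$ there is $r>0$ such that $\alpha_r(x)\ne\alpha_r(y)$. The action $\Phi$ is called generic, resp. of dense holonomy, if $G$ is. The type space $X_G$ is the set of infinite chains $\{\alpha_1\prec\alpha_2\prec\dots\}$ with $\alpha_r\in U^r_G$ for all $r\geq 1$. It is a compact metric space with the metric in which the distance of two distinct chains $\{\alpha_r\}$ and $\{\beta_r\}$ is $2^{-r}$, where $r$ is the smallest integer with $\alpha_r\ne\beta_r$. The map $\pi:X\to X_G$, $\pi(x)=\{\alpha_1(x)\prec\alpha_2(x)\prec\dots\}$, has dense image. The associated topological action $\widetilde{\Phi}$ of $\Gamma$ on $X_G$ is the unique action by homeomorphisms with $\widetilde{\Phi}(\gamma)(\pi(x))=\pi(\Phi(\gamma)(x))$ for all $\gamma\in\Gamma$, $x\in X$. Explicitly, if $\gamma$ is a word of length $n$ and $\{\alpha_1\prec\alpha_2\prec\dots\}\in X_G$, then $\widetilde{\Phi}(\gamma)(\{\alpha_r\})=\{\beta_1\prec\beta_2\prec\dots\}$, where $\beta_i=\alpha_i(\Phi(\gamma)(x_i))$ for any $x_i\in X$ whose $(i+n)$-type is $\alpha_{i+n}$. An action on a topological space is minimal if every orbit is dense. *)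

theory Defs
  imports
    "HOL-Analysis.Analysis"
    "HOL-Library.Extended_Nat"
    "HOL-Library.FuncSet"
    "HOL-Algebra.Group_Action"
begin

section \<open>The free product of four groups of order two\<close>

datatype gen = GenA | GenB | GenC | GenD

text \<open>The free product is given by its normal forms: an element is a word without two equal
  adjacent letters, so the length of the list is the word length.\<close>

fun gen_mult :: "gen \<Rightarrow> gen list \<Rightarrow> gen list" where
  "gen_mult s [] = [s]"
| "gen_mult s (t # w) = (if s = t then w else s # t # w)"

definition Z2_free_product_4 :: "gen list monoid" where
  "Z2_free_product_4 = \<lparr>carrier = {w. distinct_adj w}, mult = foldr gen_mult, one = []\<rparr>"

lemma distinct_adj_gen_mult: "distinct_adj w \<Longrightarrow> distinct_adj (gen_mult s w)"
  by (cases w) (auto simp: distinct_adj_Cons)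

lemma gen_mult_gen_mult: "distinct_adj w \<Longrightarrow> gen_mult s (gen_mult s w) = w"
  by (cases w rule: list.exhaust; cases "tl w") auto

lemma distinct_adj_foldr_gen_mult: "distinct_adj v \<Longrightarrow> distinct_adj (foldr gen_mult u v)"
  by (induction u) (auto simp: distinct_adj_gen_mult)

lemma foldr_gen_mult_gen_mult:
  assumes "distinct_adj u" "distinct_adj v"
  shows "foldr gen_mult (gen_mult s u) v = gen_mult s (foldr gen_mult u v)"
  using assms by (cases u) (auto simp: gen_mult_gen_mult distinct_adj_foldr_gen_mult)

lemma foldr_gen_mult_assoc:
  assumes "distinct_adj v" "distinct_adj w"
  shows "foldr gen_mult (foldr gen_mult u v) w = foldr gen_mult u (foldr gen_mult v w)"
  using assms
  by (induction u) (auto simp: foldr_gen_mult_gen_mult distinct_adj_foldr_gen_mult)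

lemma foldr_gen_mult_Nil: "distinct_adj u \<Longrightarrow> foldr gen_mult u [] = u"
proof (induction u)
  case (Cons s u)
  then have "foldr gen_mult u [] = u" by (auto dest: distinct_adj_ConsD)
  with Cons.prems show ?case by (cases u) auto
qed simp

lemma foldr_gen_mult_rev: "distinct_adj v \<Longrightarrow> foldr gen_mult (rev u) (foldr gen_mult u v) = v"
  by (induction u arbitrary: v) (auto simp: gen_mult_gen_mult distinct_adj_foldr_gen_mult)

lemma group_Z2_free_product_4: "group Z2_free_product_4"
proof (rule groupI)
  fix x assume "x \<in> carrier Z2_free_product_4"
  then show "\<exists>y\<in>carrier Z2_free_product_4. y \<otimes>\<^bsub>Z2_free_product_4\<^esub> x = \<one>\<^bsub>Z2_free_product_4\<^esub>"
    using foldr_gen_mult_rev[of "[]" x]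
    by (intro bexI[of _ "rev x"]) (auto simp: Z2_free_product_4_def foldr_gen_mult_Nil)
qed (auto simp: Z2_free_product_4_def distinct_adj_foldr_gen_mult foldr_gen_mult_assoc)


section \<open>Edge-colored graphs, distance and rooted balls\<close>

record ('v, 'c) colored_graph =
  verts :: "'v set"
  edges :: "'v set set"
  color :: "'v set \<Rightarrow> 'c"

definition adj :: "('v, 'c) colored_graph \<Rightarrow> ('v \<times> 'v) set" where
  "adj G = {(x, y). {x, y} \<in> edges G}"

definition gdist :: "('v, 'c) colored_graph \<Rightarrow> 'v \<Rightarrow> 'v \<Rightarrow> enat" where
  "gdist G x y = (INF n \<in> {n. (x, y) \<in> adj G ^^ n}. enat n)"

definition four_colored_graph :: "('v, gen) colored_graph \<Rightarrow> bool" where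
  "four_colored_graph G \<longleftrightarrow>
     (\<forall>e \<in> edges G. \<exists>x \<in> verts G. \<exists>y \<in> verts G. x \<noteq> y \<and> e = {x, y}) \<and>
     infinite (verts G) \<and>
     (\<forall>x \<in> verts G. \<forall>y \<in> verts G. (x, y) \<in> (adj G)\<^sup>*) \<and>
     (\<forall>e \<in> edges G. \<forall>f \<in> edges G. e \<noteq> f \<and> e \<inter> f \<noteq> {} \<longrightarrow> color G e \<noteq> color G f)"

definition ball_verts :: "('v, 'c) colored_graph \<Rightarrow> nat \<Rightarrow> 'v \<Rightarrow> 'v set" where
  "ball_verts G r x = {y \<in> verts G. gdist G x y \<le> enat r}"

text \<open>The coloring is cut down to the edges of the subgraph so that equality of induced
  subgraphs is not affected by values outside.\<close>

definition induced_subgraph :: "('v, 'c) colored_graph \<Rightarrow> 'v set \<Rightarrow> ('v, 'c) colored_graph" where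
  "induced_subgraph G S =
     \<lparr>verts = S, edges = {e \<in> edges G. e \<subseteq> S}, color = restrict (color G) {e \<in> edges G. e \<subseteq> S}\<rparr>"

type_synonym ('v, 'c) rooted_graph = "('v, 'c) colored_graph \<times> 'v"

definition rball :: "('v, 'c) colored_graph \<Rightarrow> nat \<Rightarrow> 'v \<Rightarrow> ('v, 'c) rooted_graph" where
  "rball G r x = (induced_subgraph G (ball_verts G r x), x)"

definition rooted_iso :: "('v, 'c) rooted_graph \<Rightarrow> ('v, 'c) rooted_graph \<Rightarrow> bool" where
  "rooted_iso = (\<lambda>(H, x) (K, y). \<exists>f. bij_betw f (verts H) (verts K) \<and> f x = y \<and>
     (\<forall>u \<in> verts H. \<forall>v \<in> verts H. {u, v} \<in> edges H \<longleftrightarrow> {f u, f v} \<in> edges K) \<and>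
     (\<forall>u \<in> verts H. \<forall>v \<in> verts H. {u, v} \<in> edges H \<longrightarrow> color K {f u, f v} = color H {u, v}))"


section \<open>Types\<close>

definition rballs :: "('v, 'c) colored_graph \<Rightarrow> nat \<Rightarrow> ('v, 'c) rooted_graph set" where
  "rballs G r = rball G r ` verts G"

definition rball_equiv ::
  "('v, 'c) colored_graph \<Rightarrow> nat \<Rightarrow> (('v, 'c) rooted_graph \<times> ('v, 'c) rooted_graph) set" where
  "rball_equiv G r = {(b, b'). b \<in> rballs G r \<and> b' \<in> rballs G r \<and> rooted_iso b b'}"

definition types :: "('v, 'c) colored_graph \<Rightarrow> nat \<Rightarrow> ('v, 'c) rooted_graph set set" where
  "types G r = rballs G r // rball_equiv G r"

definition rtype :: "('v, 'c) colored_graph \<Rightarrow> nat \<Rightarrow> 'v \<Rightarrow> ('v, 'c) rooted_graph set" where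
  "rtype G r x = rball_equiv G r `` {rball G r x}"

text \<open>The ball around the root of a representative of \<open>\<beta>\<close> is computed inside that
  representative; a geodesic from the root stays in the ball, so it is literally an r-ball of the
  ambient graph and may be tested for membership in the class \<open>\<alpha>\<close>.\<close>

definition type_prec ::
  "nat \<Rightarrow> ('v, 'c) rooted_graph set \<Rightarrow> ('v, 'c) rooted_graph set \<Rightarrow> bool" where
  "type_prec r \<alpha> \<beta> \<longleftrightarrow> (\<exists>(H, x) \<in> \<beta>. rball H r x \<in> \<alpha>)"

definition generic :: "('v, 'c) colored_graph \<Rightarrow> bool" where
  "generic G \<longleftrightarrow>
     (\<forall>x \<in> verts G. \<forall>y \<in> verts G. x \<noteq> y \<longrightarrow> (\<exists>r>0. rtype G r x \<noteq> rtype G r y))"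

definition dense_holonomy :: "('v, 'c) colored_graph \<Rightarrow> bool" where
  "dense_holonomy G \<longleftrightarrow>
     (\<forall>r\<ge>1. \<forall>\<alpha> \<in> types G r. \<exists>m. \<forall>y \<in> verts G. \<exists>x \<in> ball_verts G m y. rtype G r x = \<alpha>)"


section \<open>The type space\<close>

text \<open>A chain is indexed by the positive integers; its value at \<open>0\<close> is \<open>undefined\<close>.\<close>

definition type_space :: "('v, 'c) colored_graph \<Rightarrow> (nat \<Rightarrow> ('v, 'c) rooted_graph set) set" where
  "type_space G =
     {\<alpha> \<in> (\<Pi>\<^sub>E r \<in> {1..}. types G r). \<forall>r\<ge>1. type_prec r (\<alpha> r) (\<alpha> (Suc r))}"

definition type_dist :: "(nat \<Rightarrow> 'b) \<Rightarrow> (nat \<Rightarrow> 'b) \<Rightarrow> real" where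
  "type_dist \<alpha> \<beta> = (if \<alpha> = \<beta> then 0 else 1 / 2 ^ (LEAST r. r \<ge> 1 \<and> \<alpha> r \<noteq> \<beta> r))"

definition type_topology ::
  "('v, 'c) colored_graph \<Rightarrow> (nat \<Rightarrow> ('v, 'c) rooted_graph set) topology" where
  "type_topology G = Metric_space.mtopology (type_space G) type_dist"

lemma type_space_neq:
  assumes "\<alpha> \<in> type_space G" "\<beta> \<in> type_space G" "\<alpha> \<noteq> \<beta>"
  shows "\<exists>r\<ge>1. \<alpha> r \<noteq> \<beta> r"
proof (rule ccontr)
  assume "\<not> ?thesis"
  then have "\<alpha> r = \<beta> r" if "r \<in> {1..}" for r using that by auto
  with assms have "\<alpha> = \<beta>"
    by (intro PiE_ext[of \<alpha> "{1..}" "types G" \<beta>]) (auto simp: type_space_def)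
  with assms show False by simp
qed

lemma Metric_space_type_space:
  fixes G :: "('v, 'c) colored_graph"
  shows "Metric_space (type_space G) type_dist"
proof
  fix x y z assume xyz: "x \<in> type_space G" "y \<in> type_space G" "z \<in> type_space G"
  let ?L = "\<lambda>u v. LEAST r. (r::nat) \<ge> 1 \<and> u r \<noteq> v r"
  show "type_dist x z \<le> type_dist x y + type_dist y z"
  proof (cases "x = y \<or> y = z \<or> x = z")
    case True
    then show ?thesis by (auto simp: type_dist_def)
  next
    case False
    from False xyz have "\<exists>r\<ge>1. x r \<noteq> z r" by (intro type_space_neq) auto
    then have L: "?L x z \<ge> 1 \<and> x (?L x z) \<noteq> z (?L x z)"
      by (rule LeastI_ex)
    then have "x (?L x z) \<noteq> y (?L x z) \<or> y (?L x z) \<noteq> z (?L x z)" by auto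
    then have "?L x y \<le> ?L x z \<or> ?L y z \<le> ?L x z"
      using L by (metis (mono_tags, lifting) Least_le)
    then have "(1::real) / 2 ^ ?L x z \<le> 1 / 2 ^ ?L x y \<or> (1::real) / 2 ^ ?L x z \<le> 1 / 2 ^ ?L y z"
      by (auto simp: frac_le)
    moreover have "(0::real) < 1 / 2 ^ ?L x y" "(0::real) < 1 / 2 ^ ?L y z" by simp_all
    ultimately have "(1::real) / 2 ^ ?L x z \<le> 1 / 2 ^ ?L x y + 1 / 2 ^ ?L y z"
      by linarith
    with False show ?thesis by (simp add: type_dist_def)
  qed
next
  fix x y :: "nat \<Rightarrow> ('v, 'c) rooted_graph set"
  have "(\<lambda>r. r \<ge> 1 \<and> x r \<noteq> y r) = (\<lambda>r. r \<ge> 1 \<and> y r \<noteq> x r)" by metis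
  then show "type_dist x y = type_dist y x" by (simp add: type_dist_def)
qed (simp_all add: type_dist_def)


section \<open>The induced actions\<close>

definition gen_step :: "('v, gen) colored_graph \<Rightarrow> gen \<Rightarrow> 'v \<Rightarrow> 'v" where
  "gen_step G s x =
     (if \<exists>y. {x, y} \<in> edges G \<and> color G {x, y} = s
      then THE y. {x, y} \<in> edges G \<and> color G {x, y} = s else x)"

definition graph_act :: "('v, gen) colored_graph \<Rightarrow> gen list \<Rightarrow> 'v \<Rightarrow> 'v" where
  "graph_act G \<gamma> = (\<lambda>x \<in> verts G. foldr (gen_step G) \<gamma> x)"

text \<open>The chosen vertex is immaterial: acting by a word of length \<open>n\<close> moves a vertex by at most
  \<open>n\<close>, so the \<open>(i + n)\<close>-type of \<open>x\<close> determines the i-type of its image.\<close>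

definition type_act :: "('v, gen) colored_graph \<Rightarrow> gen list \<Rightarrow>
    (nat \<Rightarrow> ('v, gen) rooted_graph set) \<Rightarrow> (nat \<Rightarrow> ('v, gen) rooted_graph set)" where
  "type_act G \<gamma> = (\<lambda>\<alpha> \<in> type_space G. \<lambda>i \<in> {1..}.
     rtype G i (graph_act G \<gamma>
       (SOME x. x \<in> verts G \<and> rtype G (i + length \<gamma>) x = \<alpha> (i + length \<gamma>))))"

definition topological_action :: "('g, 'm) monoid_scheme \<Rightarrow> 'x topology \<Rightarrow> ('g \<Rightarrow> 'x \<Rightarrow> 'x) \<Rightarrow> bool"
  where "topological_action \<Gamma> T \<phi> \<longleftrightarrow>
     group_action \<Gamma> (topspace T) \<phi> \<and> (\<forall>g \<in> carrier \<Gamma>. homeomorphic_map T T (\<phi> g))"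

definition minimal_action :: "('g, 'm) monoid_scheme \<Rightarrow> 'x topology \<Rightarrow> ('g \<Rightarrow> 'x \<Rightarrow> 'x) \<Rightarrow> bool"
  where "minimal_action \<Gamma> T \<phi> \<longleftrightarrow>
     topological_action \<Gamma> T \<phi> \<and>
     (\<forall>x \<in> topspace T. T closure_of (orbit \<Gamma> \<phi> x) = topspace T)"


section \<open>The Cantor set\<close>

text \<open>The middle-thirds set; level \<open>n + 1\<close> consists of two copies of level \<open>n\<close> scaled by 1/3.\<close>

primrec cantor_level :: "nat \<Rightarrow> real set" where
  "cantor_level 0 = {0..1}"
| "cantor_level (Suc n) = (\<lambda>x. x / 3) ` cantor_level n \<union> (\<lambda>x. (x + 2) / 3) ` cantor_level n"

definition cantor_set :: "real set" where
  "cantor_set = (\<Inter>n. cantor_level n)"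

end

theory Submission
  imports Defs
begin

text \<open>Both claims rest on one reformulation of types. Every vertex of \<open>B\<^sub>r(x)\<close> is the end of a walk from
  \<open>x\<close> that reads a word of length at most \<open>r\<close>, a letter without an edge leaving the walk where it is. A
  root- and color-preserving isomorphism must carry the end of each such walk to the end of the walk
  reading the same word, so the \<open>r\<close>-type of \<open>x\<close> amounts to a finite amount of combinatorial
  information: which words of length at most \<open>r\<close> lead to the same vertex, and which of these ends
  are joined by an edge of which color (\<open>rooted_iso_iff_relations\<close>). Hence there are finitely many
  \<open>r\<close>-types, and by appending \<open>\<gamma>\<close> to all words, the \<open>i\<close>-type of \<open>\<gamma>x\<close> is seen to depend on the
  \<open>(i + |\<gamma>|)\<close>-type of \<open>x\<close> only. A finite part of a chain is the sequence of types of a single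
  vertex, so every statement about the action on chains that concerns finitely many levels can be
  checked on a vertex: chains are mapped to chains, the action is a group action, and it is
  continuous.

  The Cantor set is reached through Brouwer's characterization
  (\<open>perfect_compact_homeomorphic_binary_sequences\<close>): a nonempty compact space without isolated
  points whose points are separated by countably many clopen sets is homeomorphic to the space of
  binary sequences. It applies to the middle-thirds set, and it applies to the type space. There,
  compactness comes from the finiteness of the sets of \<open>r\<close>-types, and the cylinders, each fixing
  one entry of the chain, are the clopen sets. An isolated chain \<open>\<alpha>\<close> would be the only chain with
  a certain entry \<open>\<alpha>\<^sub>n\<close>. But balls are finite and the graph is infinite, so dense holonomy gives
  two distinct vertices of type \<open>\<alpha>\<^sub>n\<close>; both would have all types prescribed by \<open>\<alpha>\<close>, against
  genericity.

  Minimality is dense holonomy read in the type space. Given a chain \<open>\<alpha>\<close> and a \<open>k\<close>-type \<open>\<tau>\<close>, let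
  \<open>m\<close> be the radius belonging to \<open>\<tau>\<close>, and let \<open>x\<close> be a vertex whose \<open>(k + m)\<close>-type is the one in
  \<open>\<alpha>\<close>. Some word \<open>\<gamma>\<close> of length at most \<open>m\<close> leads from \<open>x\<close> to a vertex of type \<open>\<tau>\<close>, and then the
  \<open>k\<close>-th entry of \<open>\<gamma>\<alpha>\<close> is \<open>\<tau>\<close>. So each orbit meets each cylinder.\<close>

section \<open>Perfect compact spaces with a countable separating family of clopen sets\<close>

definition binary_sequences :: "(nat \<Rightarrow> bool) topology" where
  "binary_sequences = product_topology (\<lambda>_. discrete_topology UNIV) UNIV"

text \<open>The space is cut into cells, level by level, each cell into two nonempty clopen halves. A point
  is coded by the sequence of halves to which it belongs.\<close>
locale separating_clopens =
  fixes T :: "'a topology" and U :: "nat \<Rightarrow> 'a set"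
  assumes compact: "compact_space T"
    and nonempty: "topspace T \<noteq> {}"
    and open_U: "openin T (U n)"
    and closed_U: "closedin T (U n)"
    and separating: "\<lbrakk>x \<in> topspace T; y \<in> topspace T; x \<noteq> y\<rbrakk> \<Longrightarrow> \<exists>n. x \<in> U n \<longleftrightarrow> y \<notin> U n"
    and no_isolated: "x \<in> topspace T \<Longrightarrow> \<not> openin T {x}"
begin

definition splits :: "'a set \<Rightarrow> 'a set \<Rightarrow> bool" where
  "splits V C \<longleftrightarrow> C \<inter> V \<noteq> {} \<and> C - V \<noteq> {}"

text \<open>At level \<open>n\<close> a cell is cut along \<open>U n\<close> whenever this divides it; thus two points separated by
  \<open>U n\<close> are in different cells from level \<open>n + 1\<close> on, and no control of diameters is needed. If
  \<open>U n\<close> does not divide the cell, another set of the family has to do, so that both halves are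
  always nonempty.\<close>
definition cut :: "nat \<Rightarrow> 'a set \<Rightarrow> 'a set" where
  "cut n C = (if splits (U n) C then U n else U (SOME k. splits (U k) C))"

text \<open>The half to be kept is chosen by \<open>d\<close> from the level and the cutting set. With
  \<open>d n V = b n\<close> the cells follow a given binary sequence \<open>b\<close>, with \<open>d n V = (x \<in> V)\<close> they follow a
  given point \<open>x\<close>.\<close>
primrec cell :: "(nat \<Rightarrow> 'a set \<Rightarrow> bool) \<Rightarrow> nat \<Rightarrow> 'a set" where
  "cell d 0 = topspace T"
| "cell d (Suc n) = (if d n (cut n (cell d n)) then cell d n \<inter> cut n (cell d n)
                     else cell d n - cut n (cell d n))"

abbreviation cell_at :: "'a \<Rightarrow> nat \<Rightarrow> 'a set" where
  "cell_at x \<equiv> cell (\<lambda>_ V. x \<in> V)"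

definition itinerary :: "'a \<Rightarrow> nat \<Rightarrow> bool" where
  "itinerary x n \<longleftrightarrow> x \<in> cut n (cell_at x n)"

lemma cell_clopen: "openin T (cell d n) \<and> closedin T (cell d n)"
proof (induction n)
  case (Suc n)
  have "openin T (cut n C)" "closedin T (cut n C)" for C
    by (simp_all add: cut_def open_U closed_U)
  with Suc show ?case by (auto intro: openin_diff closedin_diff)
qed auto

text \<open>This is where the absence of isolated points enters: a nonempty open set has two points, and
  some set of the family separates them.\<close>
lemma splits_cut:
  assumes C: "openin T C" "C \<noteq> {}"
  shows "splits (cut n C) C"
proof -
  obtain x where x: "x \<in> C" using C by auto
  have sub: "C \<subseteq> topspace T" using C by (simp add: openin_subset)
  have "C \<noteq> {x}" using no_isolated[of x] C x sub by auto
  then obtain y where y: "y \<in> C" "y \<noteq> x" using x by auto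
  then obtain k where "x \<in> U k \<longleftrightarrow> y \<notin> U k" using separating[of x y] sub x by auto
  then have "splits (U k) C" using x y by (auto simp: splits_def)
  then have "splits (U (SOME k. splits (U k) C)) C" by (rule someI)
  then show ?thesis by (simp add: cut_def)
qed

lemma cell_nonempty: "cell d n \<noteq> {}"
proof (induction n)
  case (Suc n)
  then have "splits (cut n (cell d n)) (cell d n)"
    using cell_clopen by (blast intro: splits_cut)
  then show ?case by (auto simp: splits_def)
next
  case 0
  show ?case using nonempty by (simp only: cell.simps not_False_eq_True)
qed

lemma mem_cell_at: "x \<in> topspace T \<Longrightarrow> x \<in> cell_at x n"
  by (induction n) auto

lemma cell_at_eq_if_mem: "x \<in> cell d n \<Longrightarrow> cell_at x n = cell d n"
proof (induction n)
  case (Suc n)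
  then have "cell_at x n = cell d n" by (auto split: if_splits)
  with Suc.prems show ?case by (auto split: if_splits)
qed simp

lemma itinerary_eq_if_mem:
  assumes "x \<in> cell d (Suc n)"
  shows "itinerary x n \<longleftrightarrow> d n (cut n (cell d n))"
proof -
  from assms have "x \<in> cell d n" by (auto split: if_splits)
  then have "cell_at x n = cell d n" by (rule cell_at_eq_if_mem)
  with assms show ?thesis by (auto simp: itinerary_def split: if_splits)
qed

lemma cell_at_eq_if_itinerary_eq:
  assumes "itinerary x = itinerary y"
  shows "cell_at x n = cell_at y n"
proof (induction n)
  case (Suc n)
  have "itinerary x n \<longleftrightarrow> itinerary y n" using assms by simp
  with Suc show ?case by (simp add: itinerary_def)
qed simp

lemma inj_itinerary: "inj_on itinerary (topspace T)"
proof (rule inj_onI, rule ccontr)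
  fix x y assume xy: "x \<in> topspace T" "y \<in> topspace T" "itinerary x = itinerary y" "x \<noteq> y"
  then obtain n where n: "x \<in> U n \<longleftrightarrow> y \<notin> U n" using separating by blast
  have eq: "cell_at x n = cell_at y n" using xy by (intro cell_at_eq_if_itinerary_eq)
  have "x \<in> cell_at x n" "y \<in> cell_at x n"
    using mem_cell_at[of x n] mem_cell_at[of y n] xy eq by auto
  then have "splits (U n) (cell_at x n)" using n by (auto simp: splits_def)
  then have "cut n (cell_at x n) = U n" by (simp add: cut_def)
  moreover have "itinerary x n \<longleftrightarrow> itinerary y n" using xy by simp
  ultimately show False using n eq by (simp add: itinerary_def)
qed

text \<open>The cells along a binary sequence are nonempty, closed and decreasing, so by compactness they
  have a common point, whose itinerary is that sequence.\<close>
lemma surj_itinerary: "itinerary ` topspace T = UNIV"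
proof (intro equalityI subset_UNIV subsetI)
  fix b :: "nat \<Rightarrow> bool"
  let ?C = "cell (\<lambda>n _. b n)"
  have "?C (Suc n) \<subseteq> ?C n" for n by auto
  then have anti: "?C n \<subseteq> ?C m" if "m \<le> n" for m n
    using that by (rule lift_Suc_antimono_le)
  have "\<Inter> (range ?C) \<noteq> {}"
  proof (rule compact_space_imp_nest[OF compact])
    show "decseq ?C" using anti by (auto simp: decseq_def)
  qed (use cell_clopen cell_nonempty in auto)
  then obtain x where x: "x \<in> ?C n" for n by auto
  have "x \<in> topspace T" using x[of 0] by simp
  moreover have "itinerary x = b" using itinerary_eq_if_mem[OF x] by auto
  ultimately show "b \<in> itinerary ` topspace T" by auto
qed

text \<open>The first \<open>n + 1\<close> entries of the itinerary are constant on each cell of level \<open>n + 1\<close>, which is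
  an open set.\<close>
lemma continuous_itinerary: "continuous_map T binary_sequences itinerary"
proof -
  have "openin T {x \<in> topspace T. itinerary x n \<in> S}" for n S
  proof (subst openin_subopen, intro ballI)
    fix x assume x: "x \<in> {x \<in> topspace T. itinerary x n \<in> S}"
    have "cell_at x (Suc n) \<subseteq> {x \<in> topspace T. itinerary x n \<in> S}"
    proof
      fix y assume y: "y \<in> cell_at x (Suc n)"
      have "y \<in> topspace T" using y cell_clopen openin_subset by blast
      moreover have "itinerary y n \<longleftrightarrow> itinerary x n"
        using itinerary_eq_if_mem[OF y] by (simp add: itinerary_def)
      ultimately show "y \<in> {x \<in> topspace T. itinerary x n \<in> S}" using x by simp
    qed
    then show "\<exists>V. openin T V \<and> x \<in> V \<and> V \<subseteq> {x \<in> topspace T. itinerary x n \<in> S}"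
      using mem_cell_at[of x "Suc n"] cell_clopen x by blast
  qed
  then show ?thesis
    unfolding binary_sequences_def continuous_map_componentwise_UNIV
    by (auto simp: continuous_map_def)
qed

lemma homeomorphic_binary_sequences: "T homeomorphic_space binary_sequences"
proof -
  have "homeomorphic_map T binary_sequences itinerary"
  proof (rule continuous_imp_homeomorphic_map)
    show "Hausdorff_space binary_sequences"
      by (simp add: binary_sequences_def Hausdorff_space_product_topology)
  qed (use compact continuous_itinerary surj_itinerary inj_itinerary in
        \<open>simp_all add: binary_sequences_def\<close>)
  then show ?thesis by (rule homeomorphic_map_imp_homeomorphic_space)
qed

end

text \<open>Brouwer's characterization of the Cantor set, with total disconnectedness and metrizability
  expressed together by a countable separating family of clopen sets.\<close>
theorem perfect_compact_homeomorphic_binary_sequences: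
  assumes "compact_space T" "topspace T \<noteq> {}" "countable \<U>"
    and "\<And>V. V \<in> \<U> \<Longrightarrow> openin T V \<and> closedin T V"
    and "\<And>x y. \<lbrakk>x \<in> topspace T; y \<in> topspace T; x \<noteq> y\<rbrakk> \<Longrightarrow> \<exists>V\<in>\<U>. x \<in> V \<longleftrightarrow> y \<notin> V"
    and "\<And>x. x \<in> topspace T \<Longrightarrow> \<not> openin T {x}"
  shows "T homeomorphic_space binary_sequences"
proof -
  let ?U = "from_nat_into (insert {} \<U>)"
  have ran: "range ?U = insert {} \<U>" using assms(3) by (intro range_from_nat_into) auto
  have "openin T (?U n) \<and> closedin T (?U n)" for n
  proof -
    have "?U n \<in> insert {} \<U>" using ran by blast
    then show ?thesis using assms(4) by (elim insertE) simp_all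
  qed
  moreover have "\<exists>n. x \<in> ?U n \<longleftrightarrow> y \<notin> ?U n"
    if xy: "x \<in> topspace T" "y \<in> topspace T" "x \<noteq> y" for x y
  proof -
    obtain V where V: "V \<in> \<U>" "x \<in> V \<longleftrightarrow> y \<notin> V" using assms(5) xy by blast
    then have "V \<in> range ?U" using ran by simp
    then show ?thesis using V by blast
  qed
  ultimately interpret separating_clopens T ?U
    using assms by unfold_locales auto
  show ?thesis by (rule homeomorphic_binary_sequences)
qed

section \<open>The middle-thirds set\<close>

lemma cantor_level_subset: "cantor_level n \<subseteq> {0..1}"
  by (induction n) auto

lemma cantor_set_subset: "cantor_set \<subseteq> {0..1}"
  using cantor_level_subset[of 0] unfolding cantor_set_def by blast

text \<open>The Cantor set is self-similar: its parts on either side of \<open>1 / 2\<close> are copies of it, scaled by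
  \<open>1 / 3\<close>. The bounds on \<open>x\<close> in this lemma and the next keep the image on its own side of
  \<open>1 / 2\<close>, away from the other copy.\<close>
lemma cantor_set_left: "x / 3 \<in> cantor_set \<longleftrightarrow> x \<in> cantor_set" if "x \<le> 3 / 2"
proof
  assume x: "x / 3 \<in> cantor_set"
  have "x \<in> cantor_level n" for n
  proof -
    have "x / 3 \<in> cantor_level (Suc n)" using x by (auto simp only: cantor_set_def)
    then show ?thesis using that cantor_level_subset[of n] by force
  qed
  then show "x \<in> cantor_set" by (simp add: cantor_set_def)
next
  assume x: "x \<in> cantor_set"
  have "x / 3 \<in> cantor_level n" for n
    using x cantor_set_subset by (cases n) (auto simp: cantor_set_def)
  then show "x / 3 \<in> cantor_set" by (simp add: cantor_set_def)
qed

lemma cantor_set_right: "(x + 2) / 3 \<in> cantor_set \<longleftrightarrow> x \<in> cantor_set" if "x > - 1 / 2"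
proof
  assume x: "(x + 2) / 3 \<in> cantor_set"
  have "x \<in> cantor_level n" for n
  proof -
    have "(x + 2) / 3 \<in> cantor_level (Suc n)" using x by (auto simp only: cantor_set_def)
    then obtain y where y: "y \<in> cantor_level n" "(x + 2) / 3 = y / 3 \<or> (x + 2) / 3 = (y + 2) / 3"
      by auto
    moreover have "y \<le> 1" using y cantor_level_subset[of n] by auto
    ultimately have "x = y" using that by auto
    then show ?thesis using y by simp
  qed
  then show "x \<in> cantor_set" by (simp add: cantor_set_def)
next
  assume x: "x \<in> cantor_set"
  have "(x + 2) / 3 \<in> cantor_level n" for n
    using x cantor_set_subset by (cases n) (auto simp: cantor_set_def)
  then show "(x + 2) / 3 \<in> cantor_set" by (simp add: cantor_set_def)
qed

lemma cantor_set_cases: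
  assumes "x \<in> cantor_set"
  obtains (left) y where "y \<in> cantor_set" "x = y / 3"
  | (right) y where "y \<in> cantor_set" "x = (y + 2) / 3"
proof (cases "x \<le> 1 / 2")
  case True
  then show ?thesis using left[of "3 * x"] assms cantor_set_left[of "3 * x"] by simp
next
  case False
  then show ?thesis using right[of "3 * x - 2"] assms cantor_set_right[of "3 * x - 2"] by simp
qed

lemma half_notin_cantor_set: "1 / 2 \<notin> cantor_set"
proof
  assume "1 / 2 \<in> cantor_set"
  then show False
    by (cases rule: cantor_set_cases) (use cantor_set_subset in auto)
qed

lemma zero_in_cantor_set: "0 \<in> cantor_set"
proof -
  have "0 \<in> cantor_level n" for n by (induction n) auto
  then show ?thesis by (simp add: cantor_set_def)
qed

lemma one_in_cantor_set: "1 \<in> cantor_set"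
proof -
  have "1 \<in> cantor_level n" for n
  proof (induction n)
    case (Suc n)
    then have "(1 + 2) / 3 \<in> (\<lambda>x. (x + 2) / 3) ` cantor_level n" by blast
    then show ?case by simp
  qed simp
  then show ?thesis by (simp add: cantor_set_def)
qed

lemma compact_cantor_set: "compact cantor_set"
proof -
  have "compact (cantor_level n)" for n
    by (induction n) (auto intro!: compact_Un compact_continuous_image continuous_intros)
  then show ?thesis unfolding cantor_set_def by (intro compact_Inter) auto
qed

text \<open>By self-similarity, two points in the same third can be blown up by the factor \<open>3\<close>; points in
  different thirds are separated by \<open>1 / 2\<close>. The cut points are rational in order that there be
  only countably many.\<close>
lemma cantor_set_gap:
  assumes "x \<in> cantor_set" "y \<in> cantor_set" "y - x > 1 / 3 ^ n"
  shows "\<exists>q\<in>\<rat>. q \<notin> cantor_set \<and> x < q \<and> q < y"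
  using assms
proof (induction n arbitrary: x y)
  case 0
  then have "0 \<le> x" "y \<le> 1" using cantor_set_subset by auto
  then show ?case using 0 by simp
next
  case (Suc n)
  from Suc.prems(1) show ?case
  proof (cases rule: cantor_set_cases)
    case x: (left x')
    from Suc.prems(2) show ?thesis
    proof (cases rule: cantor_set_cases)
      case y: (left y')
      have "y' - x' = 3 * (y - x)" using x y by simp
      moreover have "1 / 3 ^ n < 3 * (y - x)" using Suc.prems(3) by (simp add: field_simps)
      ultimately have "y' - x' > 1 / 3 ^ n" by simp
      then obtain q where q: "q \<in> \<rat>" "q \<notin> cantor_set" "x' < q" "q < y'"
        using Suc.IH x y by blast
      then have "q / 3 \<notin> cantor_set"
        using cantor_set_left[of q] y cantor_set_subset by fastforce
      then show ?thesis using q x y by (intro bexI[of _ "q / 3"]) auto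
    next
      case y: (right y')
      have "x < 1 / 2" "1 / 2 < y" using x y cantor_set_subset by fastforce+
      then show ?thesis using half_notin_cantor_set by (intro bexI[of _ "1 / 2"]) auto
    qed
  next
    case x: (right x')
    from Suc.prems(2) show ?thesis
    proof (cases rule: cantor_set_cases)
      case y: (left y')
      have "y' \<le> 1" "0 \<le> x'" using x y cantor_set_subset by auto
      moreover have "y - x > 0" using Suc.prems(3) by (smt (verit) zero_less_divide_1_iff zero_less_power)
      ultimately show ?thesis using x y by simp
    next
      case y: (right y')
      have "y' - x' = 3 * (y - x)" using x y by simp
      moreover have "1 / 3 ^ n < 3 * (y - x)" using Suc.prems(3) by (simp add: field_simps)
      ultimately have "y' - x' > 1 / 3 ^ n" by simp
      then obtain q where q: "q \<in> \<rat>" "q \<notin> cantor_set" "x' < q" "q < y'"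
        using Suc.IH x y by blast
      then have "(q + 2) / 3 \<notin> cantor_set"
        using cantor_set_right[of q] x cantor_set_subset by fastforce
      then show ?thesis using q x y by (intro bexI[of _ "(q + 2) / 3"]) auto
    qed
  qed
qed

text \<open>At scale \<open>1\<close> one of the end points \<open>0\<close>, \<open>1\<close> is a second point; self-similarity carries it to
  all scales \<open>1 / 3\<^sup>n\<close>.\<close>
lemma cantor_set_perfect:
  assumes "x \<in> cantor_set"
  shows "\<exists>y\<in>cantor_set. y \<noteq> x \<and> \<bar>y - x\<bar> \<le> 1 / 3 ^ n"
  using assms
proof (induction n arbitrary: x)
  case 0
  then have "0 \<le> x" "x \<le> 1" using cantor_set_subset by auto
  then show ?case
    using zero_in_cantor_set one_in_cantor_set
    by (intro bexI[of _ "if x = 0 then 1 else 0"]) auto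
next
  case (Suc n)
  from Suc.prems show ?case
  proof (cases rule: cantor_set_cases)
    case (left x')
    then obtain y where y: "y \<in> cantor_set" "y \<noteq> x'" "\<bar>y - x'\<bar> \<le> 1 / 3 ^ n"
      using Suc.IH by blast
    moreover have "y / 3 \<in> cantor_set" using y cantor_set_left cantor_set_subset by fastforce
    ultimately show ?thesis using left
      by (intro bexI[of _ "y / 3"]) (auto simp: field_simps simp flip: diff_divide_distrib)
  next
    case (right x')
    then obtain y where y: "y \<in> cantor_set" "y \<noteq> x'" "\<bar>y - x'\<bar> \<le> 1 / 3 ^ n"
      using Suc.IH by blast
    moreover have "(y + 2) / 3 \<in> cantor_set" using y cantor_set_right cantor_set_subset by fastforce
    ultimately show ?thesis using right
      by (intro bexI[of _ "(y + 2) / 3"]) (auto simp: field_simps simp flip: diff_divide_distrib)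
  qed
qed

lemma exists_level_less: "0 < (\<epsilon>::real) \<Longrightarrow> \<exists>n\<ge>1. 1 / 2 ^ n < \<epsilon>"
proof -
  assume "0 < \<epsilon>"
  then obtain n where "(1 / 2) ^ n < \<epsilon>" using real_arch_pow_inv[of \<epsilon> "1 / 2"] by auto
  moreover have "(1 / 2 :: real) ^ Suc n \<le> (1 / 2) ^ n" by simp
  ultimately have "1 / 2 ^ Suc n < \<epsilon>" by (simp add: power_one_over)
  then show ?thesis by (intro exI[of _ "Suc n"]) simp
qed

lemma third_power_less: "0 < (\<epsilon>::real) \<Longrightarrow> \<exists>n. 1 / 3 ^ n < \<epsilon>"
  using real_arch_pow_inv[of \<epsilon> "1 / 3"] by (simp add: power_one_over)

text \<open>A cut at a rational \<open>q\<close> outside the Cantor set yields a clopen part \<open>cantor_set \<inter> {..<q}\<close>.\<close>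
lemma cantor_set_homeomorphic_binary_sequences:
  "top_of_set cantor_set homeomorphic_space binary_sequences"
proof (rule perfect_compact_homeomorphic_binary_sequences)
  let ?\<U> = "(\<lambda>q. cantor_set \<inter> {..<q}) ` (\<rat> - cantor_set)"
  show "compact_space (top_of_set cantor_set)"
    using compact_cantor_set by (simp add: compact_space_subtopology)
  show "topspace (top_of_set cantor_set) \<noteq> {}" using zero_in_cantor_set by auto
  show "countable ?\<U>" by (intro countable_image countable_Diff countable_rat)
  show "openin (top_of_set cantor_set) V \<and> closedin (top_of_set cantor_set) V" if "V \<in> ?\<U>" for V
  proof -
    from that obtain q where q: "q \<notin> cantor_set" "V = cantor_set \<inter> {..<q}" by blast
    \<comment> \<open>Replacing \<open>{..<q}\<close> by \<open>{..q}\<close> changes nothing as \<open>q\<close> is outside, so the part is closed, too.\<close>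
    then have "V = cantor_set \<inter> {..q}" by (auto simp: order.order_iff_strict)
    then show ?thesis using q
      by (metis closed_atMost closedin_closed_Int open_lessThan openin_open_Int)
  qed
  show "\<exists>V\<in>?\<U>. x \<in> V \<longleftrightarrow> y \<notin> V"
    if "x \<in> topspace (top_of_set cantor_set)" "y \<in> topspace (top_of_set cantor_set)" "x \<noteq> y" for x y
  proof -
    have gap: "\<exists>q\<in>\<rat>. q \<notin> cantor_set \<and> u < q \<and> q < v"
      if "u \<in> cantor_set" "v \<in> cantor_set" "u < v" for u v
      using third_power_less[of "v - u"] cantor_set_gap[of u v] that by auto
    have "\<exists>q\<in>\<rat>. q \<notin> cantor_set \<and> (x < q \<longleftrightarrow> \<not> y < q)"
    proof (cases "x < y")
      case True
      then show ?thesis using gap[of x y] that by (auto intro: less_imp_le)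
    next
      case False
      then have "y < x" using that by simp
      then show ?thesis using gap[of y x] that by (auto intro: less_imp_le)
    qed
    then show ?thesis using that by auto
  qed
  show "\<not> openin (top_of_set cantor_set) {x}" if "x \<in> topspace (top_of_set cantor_set)" for x
  proof
    assume "openin (top_of_set cantor_set) {x}"
    then obtain e where e: "e > 0" "\<And>y. y \<in> cantor_set \<Longrightarrow> dist y x < e \<Longrightarrow> y = x"
      unfolding openin_euclidean_subtopology_iff by auto
    obtain n where "1 / 3 ^ n < e" using third_power_less e by blast
    then show False using cantor_set_perfect[of x n] e that by (force simp: dist_real_def)
  qed
qed

section \<open>Walks and balls\<close>

text \<open>The infimum that defines the distance is attained unless it is infinite.\<close>
lemma gdist_le_iff_adj_pow: "gdist H x y \<le> enat r \<longleftrightarrow> (\<exists>n\<le>r. (x, y) \<in> adj H ^^ n)"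
proof
  assume le: "gdist H x y \<le> enat r"
  define S where "S = enat ` {n. (x, y) \<in> adj H ^^ n}"
  have gdist: "gdist H x y = Inf S" unfolding gdist_def S_def by (rule refl)
  have "S \<noteq> {}"
  proof
    assume "S = {}"
    then have "gdist H x y = \<infinity>" unfolding gdist by (simp add: top_enat_def)
    with le show False by simp
  qed
  then obtain k where "k \<in> S" by (meson ex_in_conv)
  then have "gdist H x y \<in> S" unfolding gdist by (rule wellorder_InfI)
  then obtain n where n: "gdist H x y = enat n" "(x, y) \<in> adj H ^^ n"
    unfolding S_def by (elim imageE CollectE)
  from le have "n \<le> r" unfolding n(1) by simp
  with n(2) show "\<exists>n\<le>r. (x, y) \<in> adj H ^^ n" by (intro exI conjI)
next
  assume "\<exists>n\<le>r. (x, y) \<in> adj H ^^ n"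
  then obtain n where n: "n \<le> r" "(x, y) \<in> adj H ^^ n" by (elim exE conjE)
  then have "gdist H x y \<le> enat n" unfolding gdist_def by (intro INF_lower CollectI)
  also have "enat n \<le> enat r" using n by simp
  finally show "gdist H x y \<le> enat r" .
qed

lemma ball_verts_iff_adj_pow:
  "y \<in> ball_verts H r x \<longleftrightarrow> y \<in> verts H \<and> (\<exists>n\<le>r. (x, y) \<in> adj H ^^ n)"
  unfolding ball_verts_def gdist_le_iff_adj_pow by (rule mem_Collect_eq)

lemma ball_vertsI: "\<lbrakk>y \<in> verts H; (x, y) \<in> adj H ^^ n; n \<le> r\<rbrakk> \<Longrightarrow> y \<in> ball_verts H r x"
  unfolding ball_verts_iff_adj_pow by (intro conjI exI)

lemma ball_verts_mono: "r \<le> s \<Longrightarrow> ball_verts G r x \<subseteq> ball_verts G s x"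
  unfolding subset_iff ball_verts_iff_adj_pow by (meson le_trans)

lemma induced_subgraph_induced_subgraph:
  assumes "T \<subseteq> S"
  shows "induced_subgraph (induced_subgraph G S) T = induced_subgraph G T"
proof -
  have "{e \<in> edges (induced_subgraph G S). e \<subseteq> T} = {e \<in> edges G. e \<subseteq> T}"
    using assms by (auto simp: induced_subgraph_def)
  moreover have "{e \<in> edges G. e \<subseteq> S} \<inter> {e \<in> edges G. e \<subseteq> T} = {e \<in> edges G. e \<subseteq> T}"
    using assms by auto
  ultimately show ?thesis by (simp add: induced_subgraph_def)
qed

lemma finite_words: "finite {w :: gen list. length w \<le> r}"
proof -
  have "UNIV = {GenA, GenB, GenC, GenD}" using gen.exhaust by auto
  then have "finite (UNIV :: gen set)" by (metis finite.emptyI finite.insertI)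
  from finite_lists_length_le[OF this, of r] show ?thesis by simp
qed

lemma length_gen_mult_le: "length (gen_mult s w) \<le> Suc (length w)"
  by (cases w) auto

lemma foldr_gen_mult_rev_Nil:
  assumes "distinct_adj \<gamma>"
  shows "foldr gen_mult (rev \<gamma>) \<gamma> = []" "foldr gen_mult \<gamma> (rev \<gamma>) = []"
  using foldr_gen_mult_rev[of "[]" \<gamma>] foldr_gen_mult_rev[of "[]" "rev \<gamma>"] assms
  by (simp_all add: foldr_gen_mult_Nil)

locale four_colored =
  fixes G :: "('v, gen) colored_graph"
  assumes four_colored: "four_colored_graph G"
begin

abbreviation walk :: "gen list \<Rightarrow> 'v \<Rightarrow> 'v" where
  "walk \<equiv> foldr (gen_step G)"

lemma edgeE:
  assumes "e \<in> edges G"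
  obtains x y where "x \<in> verts G" "y \<in> verts G" "x \<noteq> y" "e = {x, y}"
  using assms four_colored by (auto simp: four_colored_graph_def)

lemma edge_verts:
  assumes "{x, y} \<in> edges G"
  shows "x \<in> verts G" "y \<in> verts G" "x \<noteq> y"
  using edgeE[OF assms] by (auto simp: doubleton_eq_iff)

lemma edge_color_unique:
  assumes "{x, y} \<in> edges G" "{x, z} \<in> edges G" "color G {x, y} = color G {x, z}"
  shows "y = z"
proof -
  have "\<forall>e\<in>edges G. \<forall>f\<in>edges G. e \<noteq> f \<and> e \<inter> f \<noteq> {} \<longrightarrow> color G e \<noteq> color G f"
    using four_colored by (simp add: four_colored_graph_def)
  from this[rule_format, OF assms(1,2)] have "{x, y} = {x, z}" using assms(3) by auto
  then show ?thesis by (auto simp: doubleton_eq_iff)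
qed

lemma gen_step_eq:
  assumes "{x, y} \<in> edges G" "color G {x, y} = s"
  shows "gen_step G s x = y"
proof -
  have "(THE y. {x, y} \<in> edges G \<and> color G {x, y} = s) = y"
    using assms edge_color_unique by (intro the_equality) blast+
  then show ?thesis using assms by (auto simp: gen_step_def)
qed

lemma gen_step_cases:
  obtains (moved) "{x, gen_step G s x} \<in> edges G" "color G {x, gen_step G s x} = s"
  | (fixed) "gen_step G s x = x" "\<nexists>y. {x, y} \<in> edges G \<and> color G {x, y} = s"
proof (cases "\<exists>y. {x, y} \<in> edges G \<and> color G {x, y} = s")
  case True
  then obtain y where y: "{x, y} \<in> edges G" "color G {x, y} = s" by (elim exE conjE)
  show ?thesis by (rule moved) (simp_all add: gen_step_eq[OF y] y)
next
  case False
  show ?thesis by (rule fixed) (use False in \<open>simp_all only: gen_step_def if_False not_False_eq_True\<close>)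
qed

lemma edge_iff_gen_step:
  "{x, y} \<in> edges G \<and> color G {x, y} = s \<longleftrightarrow> gen_step G s x = y \<and> x \<noteq> y"
proof (cases x s rule: gen_step_cases)
  case moved
  then show ?thesis using gen_step_eq[of x y s] edge_verts(3)[of x y] by auto
next
  case fixed
  then show ?thesis by auto
qed

lemma gen_step_gen_step [simp]: "gen_step G s (gen_step G s x) = x"
proof (cases x s rule: gen_step_cases)
  case moved
  then show ?thesis by (intro gen_step_eq) (simp_all add: insert_commute)
qed simp

lemma gen_step_in_verts: "x \<in> verts G \<Longrightarrow> gen_step G s x \<in> verts G"
  by (cases x s rule: gen_step_cases) (auto dest: edge_verts)

lemma walk_in_verts: "x \<in> verts G \<Longrightarrow> walk w x \<in> verts G"
  by (induction w) (auto intro: gen_step_in_verts)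

lemma walk_gen_mult: "walk (gen_mult s w) x = gen_step G s (walk w x)"
  by (cases w) auto

text \<open>Cancelling two equal letters does not change the end of a walk because each generator acts as
  an involution.\<close>
lemma walk_mult: "walk (foldr gen_mult u w) x = walk u (walk w x)"
  by (induction u) (simp_all add: walk_gen_mult)

lemma walk_rev: "walk (rev w) (walk w x) = x"
  by (induction w arbitrary: x) simp_all

lemma adj_pow_imp_walk:
  assumes "(x, y) \<in> adj G ^^ n"
  shows "\<exists>w. length w = n \<and> walk w x = y"
  using assms
proof (induction n arbitrary: y)
  case (Suc n)
  then obtain z where z: "(x, z) \<in> adj G ^^ n" "{z, y} \<in> edges G" by (auto simp: adj_def)
  then obtain w where "length w = n" "walk w x = z" using Suc.IH by blast
  then show ?case using gen_step_eq[OF z(2) refl]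
    by (intro exI[of _ "color G {z, y} # w"]) simp
qed simp

lemma walk_imp_adj_pow: "\<exists>n\<le>length w. (x, walk w x) \<in> adj G ^^ n"
proof (induction w)
  case (Cons s w)
  then obtain n where n: "n \<le> length w" "(x, walk w x) \<in> adj G ^^ n" by blast
  show ?case
  proof (cases "walk w x" s rule: gen_step_cases)
    case moved
    then have "(x, walk (s # w) x) \<in> adj G ^^ Suc n" using n by (auto simp: adj_def)
    then show ?thesis using n by (intro exI[of _ "Suc n"]) simp
  next
    case fixed
    then show ?thesis using n by (intro exI[of _ n]) simp
  qed
qed auto

text \<open>A path is the walk that reads its colors; conversely, a walk becomes a path when the letters
  that do not move it are omitted.\<close>
lemma ball_verts_eq_walks:
  assumes "x \<in> verts G"
  shows "ball_verts G r x = (\<lambda>w. walk w x) ` {w. length w \<le> r}"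
proof (intro equalityI subsetI)
  fix y assume "y \<in> ball_verts G r x"
  then show "y \<in> (\<lambda>w. walk w x) ` {w. length w \<le> r}"
    using adj_pow_imp_walk by (force simp: ball_verts_iff_adj_pow)
next
  fix y assume "y \<in> (\<lambda>w. walk w x) ` {w. length w \<le> r}"
  then show "y \<in> ball_verts G r x"
    using walk_imp_adj_pow walk_in_verts[OF assms]
    by (auto simp: ball_verts_iff_adj_pow) (metis le_trans)
qed

lemma finite_ball_verts: "x \<in> verts G \<Longrightarrow> finite (ball_verts G r x)"
  by (simp add: ball_verts_eq_walks finite_words)

section \<open>Types as finite sets of relations between words\<close>

text \<open>The combinatorial content of a rooted ball: which short words lead from \<open>x\<close> to the same vertex,
  and which of their ends are joined by an edge of a given color. The inequality in the second
  component is essential: that a generator fixes a vertex at distance exactly \<open>r\<close> from the root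
  cannot be seen inside the ball.\<close>
definition relations :: "nat \<Rightarrow> 'v \<Rightarrow> (gen list \<times> gen list) set \<times> (gen \<times> gen list \<times> gen list) set" where
  "relations r x =
     ({(u, v). length u \<le> r \<and> length v \<le> r \<and> walk u x = walk v x},
      {(s, u, v). length u \<le> r \<and> length v \<le> r \<and>
         gen_step G s (walk u x) = walk v x \<and> walk u x \<noteq> walk v x})"

lemma relations_eq_iff:
  "relations r x = relations r y \<longleftrightarrow>
    (\<forall>u v. length u \<le> r \<longrightarrow> length v \<le> r \<longrightarrow> (walk u x = walk v x \<longleftrightarrow> walk u y = walk v y)) \<and>
    (\<forall>s u v. length u \<le> r \<longrightarrow> length v \<le> r \<longrightarrow> walk u x \<noteq> walk v x \<longrightarrow>
       (gen_step G s (walk u x) = walk v x \<longleftrightarrow> gen_step G s (walk u y) = walk v y))"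
  (is "_ \<longleftrightarrow> ?P \<and> ?E")
proof
  assume eq: "relations r x = relations r y"
  have P: ?P
  proof (intro allI impI)
    fix u v :: "gen list" assume "length u \<le> r" "length v \<le> r"
    then show "walk u x = walk v x \<longleftrightarrow> walk u y = walk v y"
      using arg_cong[OF eq, of "\<lambda>R. (u, v) \<in> fst R"] by (simp add: relations_def)
  qed
  moreover have ?E
  proof (intro allI impI)
    fix s and u v :: "gen list" assume "length u \<le> r" "length v \<le> r" "walk u x \<noteq> walk v x"
    then show "gen_step G s (walk u x) = walk v x \<longleftrightarrow> gen_step G s (walk u y) = walk v y"
      using arg_cong[OF eq, of "\<lambda>R. (s, u, v) \<in> snd R"] P by (simp add: relations_def)
  qed
  ultimately show "?P \<and> ?E" ..
next
  assume "?P \<and> ?E"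
  then show "relations r x = relations r y" unfolding relations_def
    by (intro arg_cong2[of _ _ _ _ Pair] Collect_cong) auto
qed

text \<open>The relations around the end of \<open>w\<close> are those among words that begin with a walk along \<open>w\<close>; as words
  are read from the right, these are the words \<open>u @ w\<close>.\<close>
lemma relations_walk_eq:
  assumes "relations (r + length w) x = relations (r + length w) y"
  shows "relations r (walk w x) = relations r (walk w y)"
proof -
  have "walk u (walk w z) = walk (u @ w) z" for u z by simp
  moreover have "length u \<le> r \<longleftrightarrow> length (u @ w) \<le> r + length w" for u by simp
  ultimately show ?thesis
    using assms unfolding relations_eq_iff by presburger
qed

lemma relations_mono:
  assumes "relations r x = relations r y" "s \<le> r"
  shows "relations s x = relations s y"
  using assms unfolding relations_eq_iff by (meson le_trans)

lemma finite_range_relations: "finite (range (relations r))"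
proof -
  have "finite (UNIV :: gen set)" using finite_words[of 1]
    by (rule finite_surj[where f = hd]) (force intro: image_eqI[of _ _ "[_]"])
  moreover define W :: "gen list set" where "W = {w. length w \<le> r}"
  ultimately have "finite (Pow (W \<times> W) \<times> Pow ((UNIV :: gen set) \<times> W \<times> W))"
    using finite_words[of r] by simp
  then show ?thesis by (rule finite_subset[rotated]) (auto simp: relations_def W_def)
qed

text \<open>Along a walk of length at most \<open>r\<close>, each letter is read at a vertex at distance less than \<open>r\<close>
  from the root, all of whose edges belong to the ball. Hence both the presence and the absence of
  an edge of a given color there are preserved by an isomorphism of rooted balls.\<close>
lemma iso_walk:
  assumes f: "bij_betw f (ball_verts G r x) (ball_verts G r y)" "f x = y"
    and edges: "\<And>u v. \<lbrakk>u \<in> ball_verts G r x; v \<in> ball_verts G r x\<rbrakk> \<Longrightarrow>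
       {u, v} \<in> edges G \<longleftrightarrow> {f u, f v} \<in> edges G"
    and colors: "\<And>u v. \<lbrakk>u \<in> ball_verts G r x; v \<in> ball_verts G r x; {u, v} \<in> edges G\<rbrakk> \<Longrightarrow>
       color G {f u, f v} = color G {u, v}"
    and verts: "x \<in> verts G" "y \<in> verts G"
    and "length w \<le> r"
  shows "f (walk w x) = walk w y"
  using \<open>length w \<le> r\<close>
proof (induction w)
  case (Cons s w)
  have mem: "walk u z \<in> ball_verts G r z" if "length u \<le> r" "z \<in> verts G" for u z
    using that by (auto simp: ball_verts_eq_walks)
  have IH: "f (walk w x) = walk w y" using Cons by simp
  show ?case
  proof (cases "walk w x" s rule: gen_step_cases)
    case moved
    then have "{f (walk w x), f (walk (s # w) x)} \<in> edges G"
      "color G {f (walk w x), f (walk (s # w) x)} = s"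
      using edges[of "walk w x" "walk (s # w) x"] colors[of "walk w x" "walk (s # w) x"]
        mem[of w x] mem[of "s # w" x] Cons.prems verts by auto
    then show ?thesis using gen_step_eq IH by simp
  next
    case fixed
    have "gen_step G s (walk w y) = walk w y"
    proof (cases "walk w y" s rule: gen_step_cases)
      case moved
      have "walk (s # w) y \<in> ball_verts G r y" using mem Cons.prems verts by blast
      then obtain v where v: "v \<in> ball_verts G r x" "f v = walk (s # w) y"
        using f by (metis bij_betw_iff_bijections)
      have "walk w x \<in> ball_verts G r x" using mem Cons.prems verts by simp
      then have "{walk w x, v} \<in> edges G" "color G {walk w x, v} = s"
        using edges[of "walk w x" v] colors[of "walk w x" v] v moved IH by auto
      then show ?thesis using fixed by blast
    qed
    then show ?thesis using fixed IH by simp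
  qed
qed (simp add: f)

text \<open>The restrictions that are part of an induced subgraph disappear because an isomorphism maps the
  one ball into the other.\<close>
lemma rooted_iso_rball_iff:
  "rooted_iso (rball G r x) (rball G r y) \<longleftrightarrow>
    (\<exists>f. bij_betw f (ball_verts G r x) (ball_verts G r y) \<and> f x = y \<and>
      (\<forall>u\<in>ball_verts G r x. \<forall>v\<in>ball_verts G r x. {u, v} \<in> edges G \<longleftrightarrow> {f u, f v} \<in> edges G) \<and>
      (\<forall>u\<in>ball_verts G r x. \<forall>v\<in>ball_verts G r x.
         {u, v} \<in> edges G \<longrightarrow> color G {f u, f v} = color G {u, v}))"
  (is "_ \<longleftrightarrow> (\<exists>f. ?iso f)")
proof -
  have "rooted_iso (rball G r x) (rball G r y) \<longleftrightarrow>
    (\<exists>f. bij_betw f (ball_verts G r x) (ball_verts G r y) \<and> f x = y \<and>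
      (\<forall>u\<in>ball_verts G r x. \<forall>v\<in>ball_verts G r x.
         {u, v} \<in> edges G \<longleftrightarrow> {f u, f v} \<in> edges G \<and> {f u, f v} \<subseteq> ball_verts G r y) \<and>
      (\<forall>u\<in>ball_verts G r x. \<forall>v\<in>ball_verts G r x. {u, v} \<in> edges G \<longrightarrow>
         restrict (color G) {e \<in> edges G. e \<subseteq> ball_verts G r y} {f u, f v} = color G {u, v}))"
    (is "_ \<longleftrightarrow> (\<exists>f. ?iso' f)")
    by (simp add: rooted_iso_def rball_def induced_subgraph_def)
  also have "\<dots> \<longleftrightarrow> (\<exists>f. ?iso f)"
  proof (rule arg_cong[of _ _ Ex], rule ext)
    fix f
    show "?iso' f \<longleftrightarrow> ?iso f"
    proof (cases "bij_betw f (ball_verts G r x) (ball_verts G r y)")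
      case True
      then have "f u \<in> ball_verts G r y" if "u \<in> ball_verts G r x" for u
        using that by (auto dest: bij_betwE)
      then show ?thesis by (auto simp: restrict_def)
    qed simp
  qed
  finally show ?thesis .
qed

text \<open>An isomorphism is compatible with walks, so it preserves all relations. Conversely, if the
  relations agree, sending the end of each walk from \<open>x\<close> to the end of the walk from \<open>y\<close> with the
  same word is well defined, and it is an isomorphism.\<close>
lemma rooted_iso_iff_relations:
  assumes x: "x \<in> verts G" and y: "y \<in> verts G"
  shows "rooted_iso (rball G r x) (rball G r y) \<longleftrightarrow> relations r x = relations r y"
proof
  assume "rooted_iso (rball G r x) (rball G r y)"
  then obtain f where f: "bij_betw f (ball_verts G r x) (ball_verts G r y)" "f x = y"
    and edges: "\<And>u v. \<lbrakk>u \<in> ball_verts G r x; v \<in> ball_verts G r x\<rbrakk> \<Longrightarrow>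
       {u, v} \<in> edges G \<longleftrightarrow> {f u, f v} \<in> edges G"
    and colors: "\<And>u v. \<lbrakk>u \<in> ball_verts G r x; v \<in> ball_verts G r x; {u, v} \<in> edges G\<rbrakk> \<Longrightarrow>
       color G {f u, f v} = color G {u, v}"
    unfolding rooted_iso_rball_iff by blast
  have walk: "f (walk w x) = walk w y" if "length w \<le> r" for w
    using iso_walk[OF f edges colors x y that] .
  have mem: "walk u x \<in> ball_verts G r x" if "length u \<le> r" for u
    using that x by (auto simp: ball_verts_eq_walks)
  have inj: "f u = f v \<longleftrightarrow> u = v" if "u \<in> ball_verts G r x" "v \<in> ball_verts G r x" for u v
    using f that by (auto simp: bij_betw_def inj_on_def)
  show "relations r x = relations r y"
    unfolding relations_eq_iff
  proof (intro conjI allI impI)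
    fix u v :: "gen list" assume uv: "length u \<le> r" "length v \<le> r"
    then show eq: "walk u x = walk v x \<longleftrightarrow> walk u y = walk v y"
      using inj[OF mem mem] walk by metis
    fix s assume "walk u x \<noteq> walk v x"
    moreover have "{walk u x, walk v x} \<in> edges G \<and> color G {walk u x, walk v x} = s \<longleftrightarrow>
        {walk u y, walk v y} \<in> edges G \<and> color G {walk u y, walk v y} = s"
      using edges[OF mem mem] colors[OF mem mem] walk uv by metis
    ultimately show "gen_step G s (walk u x) = walk v x \<longleftrightarrow> gen_step G s (walk u y) = walk v y"
      using eq unfolding edge_iff_gen_step by blast
  qed
next
  assume "relations r x = relations r y"
  then have eq: "\<And>u v. \<lbrakk>length u \<le> r; length v \<le> r\<rbrakk> \<Longrightarrow> walk u x = walk v x \<longleftrightarrow> walk u y = walk v y"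
    and step: "\<And>s u v. \<lbrakk>length u \<le> r; length v \<le> r; walk u x \<noteq> walk v x\<rbrakk> \<Longrightarrow>
      gen_step G s (walk u x) = walk v x \<longleftrightarrow> gen_step G s (walk u y) = walk v y"
    unfolding relations_eq_iff by blast+
  define f where "f z = walk (SOME w. length w \<le> r \<and> walk w x = z) y" for z
  have f: "f (walk w x) = walk w y" if "length w \<le> r" for w
  proof -
    define u where "u = (SOME u. length u \<le> r \<and> walk u x = walk w x)"
    have "length u \<le> r \<and> walk u x = walk w x" unfolding u_def
      by (rule someI[of _ w]) (simp add: that)
    moreover have "f (walk w x) = walk u y" by (simp add: f_def u_def)
    ultimately show ?thesis using eq that by metis
  qed
  have edge: "{walk u x, walk v x} \<in> edges G \<and> color G {walk u x, walk v x} = s \<longleftrightarrow>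
      {walk u y, walk v y} \<in> edges G \<and> color G {walk u y, walk v y} = s"
    if "length u \<le> r" "length v \<le> r" for u v s
    unfolding edge_iff_gen_step using eq[OF that] step[OF that] by metis
  have edges: "{walk u x, walk v x} \<in> edges G \<longleftrightarrow> {walk u y, walk v y} \<in> edges G"
    if "length u \<le> r" "length v \<le> r" for u v
    using edge[OF that] by metis
  have colors: "color G {walk u y, walk v y} = color G {walk u x, walk v x}"
    if "length u \<le> r" "length v \<le> r" "{walk u x, walk v x} \<in> edges G" for u v
    using edge[OF that(1,2)] that(3) by metis
  have "f ` ball_verts G r x = ball_verts G r y"
    using x y f by (force simp: ball_verts_eq_walks image_image)
  moreover have "inj_on f (ball_verts G r x)"
    using f eq by (auto simp: inj_on_def ball_verts_eq_walks[OF x])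
  moreover have "f x = y" using f[of "[]"] by simp
  ultimately show "rooted_iso (rball G r x) (rball G r y)"
    unfolding rooted_iso_rball_iff bij_betw_def
    by (intro exI[of _ f]) (auto simp: ball_verts_eq_walks[OF x] f edges colors)
qed

lemma rball_inject: "rball G r x = rball G r y \<longleftrightarrow> x = y"
  by (auto simp: rball_def)

lemma rball_in_rtype_iff:
  assumes "x \<in> verts G"
  shows "rball G r y \<in> rtype G r x \<longleftrightarrow> y \<in> verts G \<and> relations r x = relations r y"
  using assms rooted_iso_iff_relations[OF assms]
  by (auto simp: rtype_def rball_equiv_def rballs_def rball_inject)

lemma rtype_subset: "rtype G r x \<subseteq> rballs G r"
  by (auto simp: rtype_def rball_equiv_def)

lemma rtype_eq_iff:
  assumes "x \<in> verts G" "y \<in> verts G"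
  shows "rtype G r x = rtype G r y \<longleftrightarrow> relations r x = relations r y"
proof
  assume "rtype G r x = rtype G r y"
  then show "relations r x = relations r y"
    using assms rball_in_rtype_iff[of x r y] rball_in_rtype_iff[of y r y] by simp
next
  assume "relations r x = relations r y"
  then show "rtype G r x = rtype G r y"
    using assms rtype_subset[of r] rball_in_rtype_iff[of _ r] by (fastforce simp: rballs_def)
qed

lemma types_eq: "types G r = rtype G r ` verts G"
  by (auto simp: types_def quotient_def rtype_def rballs_def)

lemma finite_types: "finite (types G r)"
proof -
  let ?f = "\<lambda>R. rtype G r (SOME x. x \<in> verts G \<and> relations r x = R)"
  have "types G r \<subseteq> ?f ` range (relations r)"
  proof
    fix \<alpha> assume "\<alpha> \<in> types G r"
    then obtain x where x: "x \<in> verts G" "\<alpha> = rtype G r x" by (auto simp: types_eq)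
    let ?y = "SOME y. y \<in> verts G \<and> relations r y = relations r x"
    have "?y \<in> verts G \<and> relations r ?y = relations r x" by (rule someI[of _ x]) (simp add: x)
    then have "\<alpha> = ?f (relations r x)" using x rtype_eq_iff by simp
    then show "\<alpha> \<in> ?f ` range (relations r)" by blast
  qed
  then show ?thesis using finite_range_relations finite_surj by blast
qed

lemma rtype_mono:
  assumes "x \<in> verts G" "y \<in> verts G" "rtype G r x = rtype G r y" "s \<le> r"
  shows "rtype G s x = rtype G s y"
  using assms relations_mono[of r x y s] by (simp add: rtype_eq_iff)

text \<open>This is what makes the action on the type space well defined.\<close>
lemma rtype_walk_eq:
  assumes "x \<in> verts G" "y \<in> verts G" "rtype G N x = rtype G N y" "r + length w \<le> N"
  shows "rtype G r (walk w x) = rtype G r (walk w y)"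
  using assms relations_mono[of N x y] relations_walk_eq[of r w x y]
  by (simp add: rtype_eq_iff walk_in_verts)

text \<open>Shortest paths from the root to vertices at distance at most \<open>r\<close> stay inside the larger ball.\<close>
lemma rball_induced:
  assumes "r \<le> s"
  shows "rball (induced_subgraph G (ball_verts G s x)) r x = rball G r x"
proof -
  let ?H = "induced_subgraph G (ball_verts G s x)"
  have adjH: "(u, v) \<in> adj ?H \<longleftrightarrow> (u, v) \<in> adj G \<and> u \<in> ball_verts G s x \<and> v \<in> ball_verts G s x" for u v
    by (auto simp: adj_def induced_subgraph_def)
  have le: "(x, y) \<in> adj ?H ^^ n \<Longrightarrow> (x, y) \<in> adj G ^^ n" for n y
  proof (induction n arbitrary: y)
    case (Suc n)
    then obtain z where "(x, z) \<in> adj ?H ^^ n" "(z, y) \<in> adj ?H" by auto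
    then have "(x, z) \<in> adj G ^^ n" "(z, y) \<in> adj G" using Suc.IH adjH by simp_all
    then show ?case by (rule relpow_Suc_I)
  qed simp
  have ge: "\<lbrakk>(x, y) \<in> adj G ^^ n; n \<le> r; x \<in> verts G\<rbrakk> \<Longrightarrow> (x, y) \<in> adj ?H ^^ n" for n y
  proof (induction n arbitrary: y)
    case (Suc n)
    then obtain z where z: "(x, z) \<in> adj G ^^ n" "(z, y) \<in> adj G" by auto
    have "z \<in> verts G" "y \<in> verts G"
      using z(2) edge_verts(1,2)[of z y] by (simp_all add: adj_def)
    moreover have "n \<le> s" "Suc n \<le> s" using Suc.prems assms by auto
    ultimately have "z \<in> ball_verts G s x" "y \<in> ball_verts G s x"
      using ball_vertsI[OF _ z(1)] ball_vertsI[OF _ Suc.prems(1)] by simp_all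
    then have "(z, y) \<in> adj ?H" using z by (simp add: adjH)
    moreover have "(x, z) \<in> adj ?H ^^ n" using Suc z by simp
    ultimately show ?case by auto
  qed simp
  have root: "x \<in> verts G" if "(x, y) \<in> adj G ^^ n" "y \<in> verts G" for n y
  proof (cases n)
    case 0
    then show ?thesis using that by simp
  next
    case (Suc m)
    then have "(x, y) \<in> adj G ^^ Suc m" using that(1) by simp
    then obtain z where "(x, z) \<in> adj G" by (elim relpow_Suc_E2)
    then show ?thesis unfolding adj_def using edge_verts(1)[of x z] by simp
  qed
  have verts_H: "verts ?H = ball_verts G s x" by (simp add: induced_subgraph_def)
  have "ball_verts ?H r x = ball_verts G r x"
  proof (intro equalityI subsetI)
    fix y assume "y \<in> ball_verts ?H r x"
    then obtain n where n: "n \<le> r" "(x, y) \<in> adj ?H ^^ n" and "y \<in> ball_verts G s x"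
      unfolding ball_verts_iff_adj_pow[of y ?H] verts_H by (elim exE conjE)
    then have "y \<in> verts G" by (simp add: ball_verts_def)
    then show "y \<in> ball_verts G r x"
      unfolding ball_verts_iff_adj_pow using n le[OF n(2)] by (intro exI conjI)
  next
    fix y assume y: "y \<in> ball_verts G r x"
    then have mem: "y \<in> ball_verts G s x" using ball_verts_mono[OF assms] by (rule subsetD[rotated])
    obtain n where n: "n \<le> r" "(x, y) \<in> adj G ^^ n" "y \<in> verts G"
      using y unfolding ball_verts_iff_adj_pow by (elim exE conjE)
    show "y \<in> ball_verts ?H r x"
      unfolding ball_verts_iff_adj_pow[of y ?H] verts_H
      using n ge[OF n(2,1) root[OF n(2,3)]] mem by (intro exI conjI)
  qed
  then show ?thesis
    using ball_verts_mono[OF assms, of G x]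
    by (simp only: rball_def induced_subgraph_induced_subgraph)
qed

text \<open>The relation between types is witnessed by a representative of \<open>\<beta>\<close>, which is a ball of the
  graph; its root is the vertex \<open>x\<close>.\<close>
lemma type_prec_iff:
  assumes "\<alpha> \<in> types G r" "\<beta> \<in> types G (Suc r)"
  shows "type_prec r \<alpha> \<beta> \<longleftrightarrow> (\<exists>x\<in>verts G. \<alpha> = rtype G r x \<and> \<beta> = rtype G (Suc r) x)"
proof
  obtain a b where a: "a \<in> verts G" "\<alpha> = rtype G r a" and b: "b \<in> verts G" "\<beta> = rtype G (Suc r) b"
    using assms by (auto simp: types_eq)
  assume "type_prec r \<alpha> \<beta>"
  then obtain H x where Hx: "(H, x) \<in> \<beta>" "rball H r x \<in> \<alpha>" by (auto simp: type_prec_def)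
  then have "(H, x) \<in> rballs G (Suc r)" using b rtype_subset by blast
  then have eq: "(H, x) = rball G (Suc r) x" by (auto simp: rballs_def rball_def)
  then have "H = induced_subgraph G (ball_verts G (Suc r) x)" by (simp add: rball_def)
  then have "rball G r x \<in> rtype G r a" "rball G (Suc r) x \<in> rtype G (Suc r) b"
    using Hx eq a b rball_induced[of r "Suc r" x] by auto
  then show "\<exists>x\<in>verts G. \<alpha> = rtype G r x \<and> \<beta> = rtype G (Suc r) x"
    using a b by (auto simp: rball_in_rtype_iff rtype_eq_iff)
next
  assume "\<exists>x\<in>verts G. \<alpha> = rtype G r x \<and> \<beta> = rtype G (Suc r) x"
  then obtain x where x: "x \<in> verts G" "\<alpha> = rtype G r x" "\<beta> = rtype G (Suc r) x" by blast
  then have "rball G (Suc r) x \<in> \<beta>" "rball G r x \<in> \<alpha>" by (auto simp: rball_in_rtype_iff)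
  moreover have "rball G (Suc r) x = (induced_subgraph G (ball_verts G (Suc r) x), x)"
    by (simp add: rball_def)
  ultimately show "type_prec r \<alpha> \<beta>"
    unfolding type_prec_def using rball_induced[of r "Suc r" x]
    by (intro bexI[of _ "rball G (Suc r) x"]) auto
qed

section \<open>The topology of the type space\<close>

interpretation type_metric: Metric_space "type_space G" type_dist
  by (rule Metric_space_type_space)

lemma verts_nonempty: "verts G \<noteq> {}"
  using four_colored by (auto simp: four_colored_graph_def)

lemma type_space_iff:
  "\<alpha> \<in> type_space G \<longleftrightarrow> \<alpha> \<in> extensional {1..} \<and>
     (\<forall>r\<ge>1. \<exists>x\<in>verts G. \<alpha> r = rtype G r x \<and> \<alpha> (Suc r) = rtype G (Suc r) x)"
proof
  assume \<alpha>: "\<alpha> \<in> type_space G"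
  then have "\<alpha> r \<in> types G r" "type_prec r (\<alpha> r) (\<alpha> (Suc r))" if "1 \<le> r" for r
    using that by (auto simp: type_space_def)
  then have "\<exists>x\<in>verts G. \<alpha> r = rtype G r x \<and> \<alpha> (Suc r) = rtype G (Suc r) x" if "1 \<le> r" for r
    using that by (intro type_prec_iff[THEN iffD1]) simp_all
  moreover have "\<alpha> \<in> extensional {1..}" using \<alpha> by (simp add: type_space_def PiE_def)
  ultimately show "\<alpha> \<in> extensional {1..} \<and>
     (\<forall>r\<ge>1. \<exists>x\<in>verts G. \<alpha> r = rtype G r x \<and> \<alpha> (Suc r) = rtype G (Suc r) x)" by simp
next
  assume \<alpha>: "\<alpha> \<in> extensional {1..} \<and>
     (\<forall>r\<ge>1. \<exists>x\<in>verts G. \<alpha> r = rtype G r x \<and> \<alpha> (Suc r) = rtype G (Suc r) x)"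
  then have mem: "\<alpha> r \<in> types G r" if "1 \<le> r" for r
    using that unfolding types_eq by blast
  then have "type_prec r (\<alpha> r) (\<alpha> (Suc r))" if "1 \<le> r" for r
    using that \<alpha> by (intro type_prec_iff[THEN iffD2]) simp_all
  then show "\<alpha> \<in> type_space G" using \<alpha> mem by (simp add: type_space_def PiE_def)
qed

lemma chain_step:
  assumes "\<alpha> \<in> type_space G" "1 \<le> r"
  obtains x where "x \<in> verts G" "\<alpha> r = rtype G r x" "\<alpha> (Suc r) = rtype G (Suc r) x"
  using assms unfolding type_space_iff by blast

lemma chain_in_types: "\<lbrakk>\<alpha> \<in> type_space G; 1 \<le> r\<rbrakk> \<Longrightarrow> \<alpha> r \<in> types G r"
  by (auto simp: type_space_def)

text \<open>A type determines all types of smaller radius, so a vertex that realizes one entry of a chain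
  realizes all the entries before it.\<close>
lemma chain_below:
  assumes \<alpha>: "\<alpha> \<in> type_space G" and x: "x \<in> verts G" "\<alpha> N = rtype G N x"
    and r: "1 \<le> r" "r \<le> N"
  shows "\<alpha> r = rtype G r x"
  using r(2)
proof (induction rule: inc_induct)
  case (step n)
  have "1 \<le> n" using r(1) step.hyps by simp
  then obtain z where z: "z \<in> verts G" "\<alpha> n = rtype G n z" "\<alpha> (Suc n) = rtype G (Suc n) z"
    by (rule chain_step[OF \<alpha>])
  have "rtype G (Suc n) z = rtype G (Suc n) x" using z(3)[symmetric] step.IH by (rule trans)
  then show ?case unfolding z(2) using rtype_mono[OF z(1) x(1)] by simp
qed (rule x)

lemma chain_vertex:
  assumes "\<alpha> \<in> type_space G"
  obtains x where "x \<in> verts G" "\<And>r. \<lbrakk>1 \<le> r; r \<le> N\<rbrakk> \<Longrightarrow> \<alpha> r = rtype G r x"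
proof -
  have "1 \<le> max 1 N" by simp
  then obtain x where x: "x \<in> verts G" "\<alpha> (max 1 N) = rtype G (max 1 N) x"
    by (rule chain_step[OF assms])
  show ?thesis using that[OF x(1)] chain_below[OF assms x] by simp
qed

lemma chain_eq_below:
  assumes "\<alpha> \<in> type_space G" "\<beta> \<in> type_space G" "\<alpha> N = \<beta> N" "1 \<le> r" "r \<le> N"
  shows "\<alpha> r = \<beta> r"
proof -
  obtain x where x: "x \<in> verts G" "\<And>r. \<lbrakk>1 \<le> r; r \<le> N\<rbrakk> \<Longrightarrow> \<alpha> r = rtype G r x"
    using chain_vertex[OF assms(1), of N] by blast
  then show ?thesis using chain_below[OF assms(2), of x N r] assms by simp
qed

definition vertex_chain :: "'v \<Rightarrow> nat \<Rightarrow> ('v, gen) rooted_graph set" where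
  "vertex_chain x = (\<lambda>r\<in>{1..}. rtype G r x)"

lemma vertex_chain_in_type_space: "x \<in> verts G \<Longrightarrow> vertex_chain x \<in> type_space G"
  unfolding type_space_iff vertex_chain_def by auto

lemma chain_ext:
  assumes "\<alpha> \<in> type_space G" "\<beta> \<in> type_space G" "\<And>r. 1 \<le> r \<Longrightarrow> \<alpha> r = \<beta> r"
  shows "\<alpha> = \<beta>"
  using assms type_space_neq by blast

text \<open>Since one entry of a chain determines the previous ones, the balls of radius \<open>1 / 2\<^sup>n\<close> are the
  cylinders of level \<open>n\<close>.\<close>
lemma type_dist_less_iff:
  assumes "\<alpha> \<in> type_space G" "\<beta> \<in> type_space G" "1 \<le> n"
  shows "type_dist \<alpha> \<beta> < 1 / 2 ^ n \<longleftrightarrow> \<alpha> n = \<beta> n"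
proof (cases "\<alpha> = \<beta>")
  case False
  define L where "L = (LEAST r. 1 \<le> r \<and> \<alpha> r \<noteq> \<beta> r)"
  have L: "1 \<le> L \<and> \<alpha> L \<noteq> \<beta> L"
    unfolding L_def by (rule LeastI_ex) (use type_space_neq[OF assms(1,2) False] in simp)
  have "type_dist \<alpha> \<beta> < 1 / 2 ^ n \<longleftrightarrow> n < L"
    using False by (simp add: type_dist_def L_def field_simps)
  also have "\<dots> \<longleftrightarrow> \<alpha> n = \<beta> n"
  proof
    assume "n < L"
    then show "\<alpha> n = \<beta> n" using not_less_Least[of n "\<lambda>r. 1 \<le> r \<and> \<alpha> r \<noteq> \<beta> r"] assms(3) by (simp add: L_def)
  next
    assume "\<alpha> n = \<beta> n"
    then have "\<not> L \<le> n" using L chain_eq_below[OF assms(1,2), of n L] by auto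
    then show "n < L" by simp
  qed
  finally show ?thesis .
qed (simp add: type_dist_def)

lemma topspace_type_topology [simp]: "topspace (type_topology G) = type_space G"
  by (simp add: type_topology_def)

lemma openin_type_topology_iff:
  "openin (type_topology G) S \<longleftrightarrow> S \<subseteq> type_space G \<and>
     (\<forall>\<alpha>\<in>S. \<exists>n\<ge>1. \<forall>\<beta>\<in>type_space G. \<beta> n = \<alpha> n \<longrightarrow> \<beta> \<in> S)"
proof -
  have "(\<exists>\<epsilon>>0. type_metric.mball \<alpha> \<epsilon> \<subseteq> S) \<longleftrightarrow>
      (\<exists>n\<ge>1. \<forall>\<beta>\<in>type_space G. \<beta> n = \<alpha> n \<longrightarrow> \<beta> \<in> S)" if \<alpha>: "\<alpha> \<in> type_space G" for \<alpha>
  proof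
    assume "\<exists>\<epsilon>>0. type_metric.mball \<alpha> \<epsilon> \<subseteq> S"
    then obtain \<epsilon> where \<epsilon>: "\<epsilon> > 0" "type_metric.mball \<alpha> \<epsilon> \<subseteq> S" by blast
    obtain n where n: "n \<ge> 1" "1 / 2 ^ n < \<epsilon>" using exists_level_less[OF \<epsilon>(1)] by blast
    have "\<beta> \<in> S" if \<beta>: "\<beta> \<in> type_space G" "\<beta> n = \<alpha> n" for \<beta>
    proof -
      have "type_dist \<alpha> \<beta> < 1 / 2 ^ n" using type_dist_less_iff[OF \<alpha> \<beta>(1) n(1)] \<beta> by simp
      then show ?thesis using \<epsilon> n \<alpha> \<beta> by (auto simp: subset_iff)
    qed
    then show "\<exists>n\<ge>1. \<forall>\<beta>\<in>type_space G. \<beta> n = \<alpha> n \<longrightarrow> \<beta> \<in> S" using n by blast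
  next
    assume "\<exists>n\<ge>1. \<forall>\<beta>\<in>type_space G. \<beta> n = \<alpha> n \<longrightarrow> \<beta> \<in> S"
    then obtain n where n: "n \<ge> 1" "\<forall>\<beta>\<in>type_space G. \<beta> n = \<alpha> n \<longrightarrow> \<beta> \<in> S" by blast
    have "type_metric.mball \<alpha> (1 / 2 ^ n) \<subseteq> S"
      using n type_dist_less_iff[OF \<alpha>] by (auto simp: type_metric.in_mball)
    then show "\<exists>\<epsilon>>0. type_metric.mball \<alpha> \<epsilon> \<subseteq> S" by (intro exI[of _ "1 / 2 ^ n"]) simp
  qed
  then show ?thesis
    unfolding type_topology_def type_metric.openin_mtopology by blast
qed

lemma openin_type_topologyE:
  assumes "openin (type_topology G) S" "\<alpha> \<in> S"
  obtains n where "1 \<le> n" "\<forall>\<beta>\<in>type_space G. \<beta> n = \<alpha> n \<longrightarrow> \<beta> \<in> S"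
proof -
  have "\<forall>\<alpha>\<in>S. \<exists>n\<ge>1. \<forall>\<beta>\<in>type_space G. \<beta> n = \<alpha> n \<longrightarrow> \<beta> \<in> S"
    by (rule conjunct2[OF openin_type_topology_iff[THEN iffD1, OF assms(1)]])
  from bspec[OF this assms(2)] show ?thesis using that by (elim exE conjE)
qed

definition cylinder :: "nat \<Rightarrow> ('v, gen) rooted_graph set \<Rightarrow> (nat \<Rightarrow> ('v, gen) rooted_graph set) set" where
  "cylinder n \<tau> = {\<alpha> \<in> type_space G. \<alpha> n = \<tau>}"

lemma cylinder_clopen:
  assumes "1 \<le> n"
  shows "openin (type_topology G) (cylinder n \<tau>)" "closedin (type_topology G) (cylinder n \<tau>)"
proof -
  show "openin (type_topology G) (cylinder n \<tau>)"
    unfolding openin_type_topology_iff cylinder_def using assms by auto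
  have "openin (type_topology G) (type_space G - cylinder n \<tau>)"
    unfolding openin_type_topology_iff cylinder_def using assms by auto
  then show "closedin (type_topology G) (cylinder n \<tau>)"
    by (auto simp: closedin_def cylinder_def)
qed

text \<open>Each entry is eventually constant along a Cauchy sequence. The eventual values form a chain since
  any two consecutive ones occur together in a late member of the sequence.\<close>
lemma mcomplete_type_space: "type_metric.mcomplete"
  unfolding type_metric.mcomplete_def
proof (intro allI impI)
  fix \<sigma> assume "type_metric.MCauchy \<sigma>"
  then have \<sigma>: "\<sigma> n \<in> type_space G"
    and cauchy: "\<epsilon> > 0 \<Longrightarrow> \<exists>N. \<forall>n n'. N \<le> n \<longrightarrow> N \<le> n' \<longrightarrow> type_dist (\<sigma> n) (\<sigma> n') < \<epsilon>" for n \<epsilon>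
    by (auto simp: type_metric.MCauchy_def)
  have "\<exists>N. \<forall>n\<ge>N. \<sigma> n r = \<sigma> N r" if r: "1 \<le> r" for r
  proof -
    obtain N where N: "\<And>n n'. N \<le> n \<Longrightarrow> N \<le> n' \<Longrightarrow> type_dist (\<sigma> n) (\<sigma> n') < 1 / 2 ^ r"
      using cauchy[of "1 / 2 ^ r"] by auto
    then show ?thesis using type_dist_less_iff[OF \<sigma> \<sigma> r] by blast
  qed
  then obtain N where N: "\<And>r n. \<lbrakk>1 \<le> r; N r \<le> n\<rbrakk> \<Longrightarrow> \<sigma> n r = \<sigma> (N r) r" by metis
  define \<alpha> where "\<alpha> = (\<lambda>r\<in>{1..}. \<sigma> (N r) r)"
  have \<alpha>: "\<alpha> r = \<sigma> n r" if "1 \<le> r" "N r \<le> n" for r n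
    using N[OF that] that by (simp add: \<alpha>_def)
  have mem: "\<alpha> \<in> type_space G"
    unfolding type_space_iff
  proof (intro conjI allI impI)
    fix r :: nat assume r: "1 \<le> r"
    define n where "n = max (N r) (N (Suc r))"
    have "\<alpha> r = \<sigma> n r" "\<alpha> (Suc r) = \<sigma> n (Suc r)" using r \<alpha> by (simp_all add: n_def)
    then show "\<exists>x\<in>verts G. \<alpha> r = rtype G r x \<and> \<alpha> (Suc r) = rtype G (Suc r) x"
      using \<sigma>[of n] r unfolding type_space_iff by simp
  qed (simp add: \<alpha>_def)
  have "\<exists>M. \<forall>n\<ge>M. \<sigma> n \<in> type_space G \<and> type_dist (\<sigma> n) \<alpha> < \<epsilon>" if \<epsilon>: "\<epsilon> > 0" for \<epsilon>
  proof -
    obtain r where r: "r \<ge> 1" "1 / 2 ^ r < \<epsilon>" using exists_level_less[OF \<epsilon>] by blast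
    have "type_dist (\<sigma> n) \<alpha> < \<epsilon>" if n: "N r \<le> n" for n
    proof -
      have "type_dist (\<sigma> n) \<alpha> < 1 / 2 ^ r"
        unfolding type_dist_less_iff[OF \<sigma> mem r(1)] by (rule \<alpha>[OF r(1) n, symmetric])
      then show ?thesis using r(2) by (rule order_less_trans)
    qed
    then show ?thesis using \<sigma> by (intro exI[of _ "N r"]) simp
  qed
  then show "\<exists>\<alpha>. limitin type_metric.mtopology \<sigma> \<alpha> sequentially"
    using mem unfolding type_metric.limit_metric_sequentially by blast
qed

text \<open>There are finitely many types of each radius, hence finitely many cylinders of each level.\<close>
lemma mtotally_bounded_type_space: "type_metric.mtotally_bounded (type_space G)"
  unfolding type_metric.mtotally_bounded_def
proof (intro allI impI)
  fix \<epsilon> :: real assume "\<epsilon> > 0"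
  then obtain n where n: "n \<ge> 1" "1 / 2 ^ n < \<epsilon>" using exists_level_less by blast
  have fin: "finite ((\<lambda>\<alpha>. \<alpha> n) ` type_space G)"
  proof (rule finite_subset[OF _ finite_types[of n]])
    show "(\<lambda>\<alpha>. \<alpha> n) ` type_space G \<subseteq> types G n"
      using chain_in_types n(1) by (intro image_subsetI)
  qed
  obtain K where K: "K \<subseteq> type_space G" "finite K"
      "(\<lambda>\<alpha>. \<alpha> n) ` type_space G = (\<lambda>\<alpha>. \<alpha> n) ` K"
    using finite_subset_image[OF fin order_refl] by (elim exE conjE)
  have "type_space G \<subseteq> (\<Union>\<alpha>\<in>K. type_metric.mball \<alpha> \<epsilon>)"
  proof
    fix \<beta> assume \<beta>: "\<beta> \<in> type_space G"
    then have "\<beta> n \<in> (\<lambda>\<alpha>. \<alpha> n) ` K" using K(3) by blast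
    then obtain \<alpha> where \<alpha>: "\<alpha> \<in> K" "\<beta> n = \<alpha> n" by (elim imageE)
    then have "type_dist \<alpha> \<beta> < 1 / 2 ^ n" using K \<beta> n by (subst type_dist_less_iff) auto
    then show "\<beta> \<in> (\<Union>\<alpha>\<in>K. type_metric.mball \<alpha> \<epsilon>)" using \<alpha> \<beta> K n
      by (intro UN_I[of \<alpha>]) (auto simp: type_metric.in_mball)
  qed
  then show "\<exists>K. finite K \<and> K \<subseteq> type_space G \<and> type_space G \<subseteq> (\<Union>\<alpha>\<in>K. type_metric.mball \<alpha> \<epsilon>)"
    using K by (intro exI[of _ K]) simp
qed

lemma compact_type_space: "compact_space (type_topology G)"
  unfolding type_topology_def type_metric.compact_space_eq_mcomplete_mtotally_bounded
  using mcomplete_type_space mtotally_bounded_type_space ..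

lemma dense_holonomyE:
  assumes "dense_holonomy G" "1 \<le> r" "\<tau> \<in> types G r"
  obtains m where "\<And>z. z \<in> verts G \<Longrightarrow> \<exists>x\<in>ball_verts G m z. rtype G r x = \<tau>"
proof -
  have "\<exists>m. \<forall>z\<in>verts G. \<exists>x\<in>ball_verts G m z. rtype G r x = \<tau>"
    using assms by (simp add: dense_holonomy_def)
  then obtain m where "\<forall>z\<in>verts G. \<exists>x\<in>ball_verts G m z. rtype G r x = \<tau>" by (elim exE)
  then show ?thesis using that[of m] by simp
qed

section \<open>The type space is a Cantor set\<close>

text \<open>Balls are finite and the graph is infinite, so there is a ball of the radius given by dense
  holonomy that misses the first vertex of type \<open>\<tau>\<close>; it contains another one.\<close>
lemma two_vertices_of_type:
  assumes "dense_holonomy G" "1 \<le> r" "\<tau> \<in> types G r"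
  obtains x y where "x \<in> verts G" "y \<in> verts G" "x \<noteq> y" "rtype G r x = \<tau>" "rtype G r y = \<tau>"
proof -
  obtain m where m: "\<And>z. z \<in> verts G \<Longrightarrow> \<exists>x\<in>ball_verts G m z. rtype G r x = \<tau>"
    using dense_holonomyE[OF assms(1-3)] by blast
  obtain x where x: "x \<in> verts G" "rtype G r x = \<tau>" using assms(3) by (auto simp: types_eq)
  have "infinite (verts G)" using four_colored by (simp add: four_colored_graph_def)
  then have "\<not> verts G \<subseteq> ball_verts G m x" using finite_ball_verts[OF x(1)] finite_subset by blast
  then obtain z where z: "z \<in> verts G" "z \<notin> ball_verts G m x" by blast
  obtain y where y: "y \<in> ball_verts G m z" "rtype G r y = \<tau>" using m[OF z(1)] by blast
  have "x \<notin> ball_verts G m z"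
  proof
    assume "x \<in> ball_verts G m z"
    then obtain w where w: "length w \<le> m" "x = walk w z"
      unfolding ball_verts_eq_walks[OF z(1)] by (elim imageE CollectE)
    then have "z = walk (rev w) x" using walk_rev by simp
    then have "z \<in> ball_verts G m x"
      unfolding ball_verts_eq_walks[OF x(1)] using w by (intro image_eqI[of _ _ "rev w"]) auto
    with z show False by simp
  qed
  then have "x \<noteq> y" using y by blast
  moreover have "y \<in> verts G" using y by (simp add: ball_verts_def)
  ultimately show ?thesis using that x y by blast
qed

text \<open>An isolated chain would be the chain of types of two distinct vertices, which genericity
  excludes.\<close>
lemma type_space_perfect:
  assumes "generic G" "dense_holonomy G"
  shows "\<not> openin (type_topology G) {\<alpha>}"
proof
  assume iso: "openin (type_topology G) {\<alpha>}"
  have \<alpha>: "\<alpha> \<in> type_space G" using openin_subset[OF iso] by simp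
  obtain n where n: "1 \<le> n" "\<forall>\<beta>\<in>type_space G. \<beta> n = \<alpha> n \<longrightarrow> \<beta> \<in> {\<alpha>}"
    by (rule openin_type_topologyE[OF iso singletonI])
  have "\<alpha> n \<in> types G n" using \<alpha> n(1) by (rule chain_in_types)
  then obtain x y where xy: "x \<in> verts G" "y \<in> verts G" "x \<noteq> y"
      "rtype G n x = \<alpha> n" "rtype G n y = \<alpha> n"
    using two_vertices_of_type[OF assms(2) n(1)] by metis
  then have "vertex_chain x = \<alpha>" "vertex_chain y = \<alpha>"
    using n vertex_chain_in_type_space by (simp_all add: vertex_chain_def)
  then have eq: "vertex_chain x = vertex_chain y" by simp
  have "rtype G r x = rtype G r y" if "r > 0" for r
    using fun_cong[OF eq, of r] that by (simp add: vertex_chain_def)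
  moreover have "\<exists>r>0. rtype G r x \<noteq> rtype G r y" using assms(1) xy(1-3) by (simp add: generic_def)
  ultimately show False by auto
qed

theorem type_space_homeomorphic_cantor_set:
  assumes "generic G" "dense_holonomy G"
  shows "type_topology G homeomorphic_space top_of_set cantor_set"
proof -
  have "type_topology G homeomorphic_space binary_sequences"
  proof (rule perfect_compact_homeomorphic_binary_sequences)
    let ?\<U> = "\<Union>n\<in>{1..}. cylinder n ` types G n"
    show "compact_space (type_topology G)" by (rule compact_type_space)
    show "topspace (type_topology G) \<noteq> {}"
      using verts_nonempty vertex_chain_in_type_space by (metis ex_in_conv topspace_type_topology)
    show "countable ?\<U>"
      by (intro countable_UN countable_image countableI_type countable_finite finite_types)
    show "openin (type_topology G) V \<and> closedin (type_topology G) V" if "V \<in> ?\<U>" for V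
      using that cylinder_clopen by auto
    show "\<exists>V\<in>?\<U>. \<alpha> \<in> V \<longleftrightarrow> \<beta> \<notin> V"
      if "\<alpha> \<in> topspace (type_topology G)" "\<beta> \<in> topspace (type_topology G)" "\<alpha> \<noteq> \<beta>" for \<alpha> \<beta>
    proof -
      have mem: "\<alpha> \<in> type_space G" "\<beta> \<in> type_space G" and neq: "\<alpha> \<noteq> \<beta>"
        using that by simp_all
      obtain r where r: "r \<ge> 1" "\<alpha> r \<noteq> \<beta> r"
        using type_space_neq[OF mem neq] by (elim exE conjE)
      have "\<alpha> r \<in> types G r" using mem(1) r(1) by (rule chain_in_types)
      then have "cylinder r (\<alpha> r) \<in> ?\<U>" using r by blast
      moreover have "\<alpha> \<in> cylinder r (\<alpha> r)" "\<beta> \<notin> cylinder r (\<alpha> r)"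
        using mem r by (simp_all add: cylinder_def)
      ultimately show ?thesis by blast
    qed
    show "\<not> openin (type_topology G) {\<alpha>}" for \<alpha> using type_space_perfect[OF assms] .
  qed
  moreover have "binary_sequences homeomorphic_space top_of_set cantor_set"
    by (rule homeomorphic_space_sym[THEN iffD1, OF cantor_set_homeomorphic_binary_sequences])
  ultimately show ?thesis by (rule homeomorphic_space_trans)
qed

section \<open>The action on the type space\<close>

lemma graph_act_eq: "x \<in> verts G \<Longrightarrow> graph_act G \<gamma> x = walk \<gamma> x"
  by (simp add: graph_act_def)

text \<open>An entry of the image chain can be computed with any vertex that realizes the given chain far
  enough; one vertex then serves for several entries and several group elements.\<close>
lemma type_act_eq:
  assumes \<alpha>: "\<alpha> \<in> type_space G" and x: "x \<in> verts G" "\<alpha> N = rtype G N x"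
    and "1 \<le> i" "i + length \<gamma> \<le> N"
  shows "type_act G \<gamma> \<alpha> i = rtype G i (walk \<gamma> x)"
proof -
  define n where "n = i + length \<gamma>"
  define z where "z = (SOME z. z \<in> verts G \<and> rtype G n z = \<alpha> n)"
  have eq: "\<alpha> n = rtype G n x" using chain_below[OF \<alpha> x, of n] assms by (simp add: n_def)
  have z: "z \<in> verts G \<and> rtype G n z = \<alpha> n"
    unfolding z_def by (rule someI[of _ x]) (simp add: eq x)
  have "type_act G \<gamma> \<alpha> i = rtype G i (graph_act G \<gamma> z)"
    using \<alpha> assms by (simp add: type_act_def z_def n_def)
  also have "\<dots> = rtype G i (walk \<gamma> z)" using z by (simp add: graph_act_eq)
  also have "\<dots> = rtype G i (walk \<gamma> x)"
    using z eq x by (intro rtype_walk_eq[of _ _ n]) (simp_all add: n_def)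
  finally show ?thesis .
qed

lemma type_act_in_type_space:
  assumes \<alpha>: "\<alpha> \<in> type_space G"
  shows "type_act G \<gamma> \<alpha> \<in> type_space G"
  unfolding type_space_iff
proof (intro conjI allI impI)
  show "type_act G \<gamma> \<alpha> \<in> extensional {1..}" using \<alpha> by (simp add: type_act_def)
  fix r :: nat assume r: "1 \<le> r"
  define N where "N = Suc r + length \<gamma>"
  obtain x where x: "x \<in> verts G" "\<And>r. \<lbrakk>1 \<le> r; r \<le> N\<rbrakk> \<Longrightarrow> \<alpha> r = rtype G r x"
    using chain_vertex[OF \<alpha>, of N] by blast
  have "\<alpha> N = rtype G N x" using x by (simp add: N_def)
  note eq = type_act_eq[OF \<alpha> x(1) this, where \<gamma> = \<gamma>]
  have "type_act G \<gamma> \<alpha> r = rtype G r (walk \<gamma> x)"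
    "type_act G \<gamma> \<alpha> (Suc r) = rtype G (Suc r) (walk \<gamma> x)"
    using r by (auto intro!: eq simp: N_def)
  then show "\<exists>x\<in>verts G. type_act G \<gamma> \<alpha> r = rtype G r x \<and> type_act G \<gamma> \<alpha> (Suc r) = rtype G (Suc r) x"
    using walk_in_verts[OF x(1)] by blast
qed

text \<open>The level \<open>N\<close> in the proof suffices for each of the three words, so the equation reduces to the
  action on one vertex.\<close>
lemma type_act_mult:
  assumes \<alpha>: "\<alpha> \<in> type_space G"
  shows "type_act G (foldr gen_mult \<gamma> \<delta>) \<alpha> = type_act G \<gamma> (type_act G \<delta> \<alpha>)"
proof (rule chain_ext)
  fix i :: nat assume i: "1 \<le> i"
  define N where "N = i + length \<gamma> + length \<delta> + length (foldr gen_mult \<gamma> \<delta>)"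
  obtain x where x: "x \<in> verts G" "\<And>r. \<lbrakk>1 \<le> r; r \<le> N\<rbrakk> \<Longrightarrow> \<alpha> r = rtype G r x"
    using chain_vertex[OF \<alpha>, of N] by blast
  have N: "\<alpha> N = rtype G N x" using x i by (simp add: N_def)
  have "type_act G \<delta> \<alpha> (i + length \<gamma>) = rtype G (i + length \<gamma>) (walk \<delta> x)"
    using type_act_eq[OF \<alpha> x(1) N, of "i + length \<gamma>" \<delta>] i by (simp add: N_def)
  then have "type_act G \<gamma> (type_act G \<delta> \<alpha>) i = rtype G i (walk \<gamma> (walk \<delta> x))"
    using type_act_eq[OF type_act_in_type_space[OF \<alpha>] walk_in_verts[OF x(1)]] i by simp
  also have "\<dots> = type_act G (foldr gen_mult \<gamma> \<delta>) \<alpha> i"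
    using type_act_eq[OF \<alpha> x(1) N i, of "foldr gen_mult \<gamma> \<delta>"] by (simp add: N_def walk_mult)
  finally show "type_act G (foldr gen_mult \<gamma> \<delta>) \<alpha> i = type_act G \<gamma> (type_act G \<delta> \<alpha>) i" ..
qed (intro type_act_in_type_space \<alpha>)+

lemma type_act_Nil:
  assumes \<alpha>: "\<alpha> \<in> type_space G"
  shows "type_act G [] \<alpha> = \<alpha>"
proof (rule chain_ext[OF type_act_in_type_space[OF \<alpha>] \<alpha>])
  fix i :: nat assume i: "1 \<le> i"
  obtain x where x: "x \<in> verts G" "\<And>r. \<lbrakk>1 \<le> r; r \<le> i\<rbrakk> \<Longrightarrow> \<alpha> r = rtype G r x"
    using chain_vertex[OF \<alpha>, of i] by blast
  then show "type_act G [] \<alpha> i = \<alpha> i" using type_act_eq[OF \<alpha> x(1), of i i "[]"] i by simp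
qed

lemma type_act_inverse:
  assumes "distinct_adj \<gamma>" "\<alpha> \<in> type_space G"
  shows "type_act G (rev \<gamma>) (type_act G \<gamma> \<alpha>) = \<alpha>" "type_act G \<gamma> (type_act G (rev \<gamma>) \<alpha>) = \<alpha>"
  using type_act_mult[OF assms(2), of "rev \<gamma>" \<gamma>] type_act_mult[OF assms(2), of \<gamma> "rev \<gamma>"]
    foldr_gen_mult_rev_Nil[OF assms(1)] type_act_Nil[OF assms(2)] by simp_all

lemma continuous_type_act: "continuous_map (type_topology G) (type_topology G) (type_act G \<gamma>)"
  unfolding continuous_map_def
proof (intro conjI allI impI)
  show "type_act G \<gamma> \<in> topspace (type_topology G) \<rightarrow> topspace (type_topology G)"
    using type_act_in_type_space by simp
  fix S assume S: "openin (type_topology G) S"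
  have "\<exists>n\<ge>1. \<forall>\<beta>\<in>type_space G. \<beta> n = \<alpha> n \<longrightarrow> type_act G \<gamma> \<beta> \<in> S"
    if \<alpha>: "\<alpha> \<in> type_space G" "type_act G \<gamma> \<alpha> \<in> S" for \<alpha>
  proof -
    obtain n where n: "n \<ge> 1"
        "\<forall>\<beta>\<in>type_space G. \<beta> n = type_act G \<gamma> \<alpha> n \<longrightarrow> \<beta> \<in> S"
      by (rule openin_type_topologyE[OF S \<alpha>(2)])
    define N where "N = n + length \<gamma>"
    obtain x where x: "x \<in> verts G" "\<And>r. \<lbrakk>1 \<le> r; r \<le> N\<rbrakk> \<Longrightarrow> \<alpha> r = rtype G r x"
      using chain_vertex[OF \<alpha>(1), of N] by blast
    have eq: "type_act G \<gamma> \<beta> n = rtype G n (walk \<gamma> x)" if "\<beta> \<in> type_space G" "\<beta> N = \<alpha> N" for \<beta>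
      using type_act_eq[OF that(1) x(1), of N n \<gamma>] that x n by (simp add: N_def)
    have "type_act G \<gamma> \<beta> \<in> S" if "\<beta> \<in> type_space G" "\<beta> N = \<alpha> N" for \<beta>
      using n(2)[rule_format, OF type_act_in_type_space[OF that(1)]] eq[OF that] eq[OF \<alpha>(1)] by simp
    then show ?thesis using n by (intro exI[of _ N]) (auto simp: N_def)
  qed
  then show "openin (type_topology G) {\<alpha> \<in> topspace (type_topology G). type_act G \<gamma> \<alpha> \<in> S}"
    unfolding openin_type_topology_iff by auto
qed

lemma homeomorphic_type_act:
  assumes "distinct_adj \<gamma>"
  shows "homeomorphic_map (type_topology G) (type_topology G) (type_act G \<gamma>)"
proof -
  have "homeomorphic_maps (type_topology G) (type_topology G) (type_act G \<gamma>) (type_act G (rev \<gamma>))"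
    unfolding homeomorphic_maps_def
    using continuous_type_act type_act_inverse[OF assms] by simp
  then show ?thesis by (rule homeomorphic_maps_map[THEN iffD1, THEN conjunct1])
qed

lemma group_action_type_act: "group_action Z2_free_product_4 (type_space G) (type_act G)"
proof -
  have Bij: "type_act G \<gamma> \<in> Bij (type_space G)" if "distinct_adj \<gamma>" for \<gamma>
  proof -
    have "bij_betw (type_act G \<gamma>) (type_space G) (type_space G)"
      using type_act_inverse[OF that] type_act_in_type_space
      by (intro bij_betwI[where g = "type_act G (rev \<gamma>)"]) auto
    then show ?thesis by (simp add: Bij_def type_act_def)
  qed
  have "type_act G (foldr gen_mult \<gamma> \<delta>) = compose (type_space G) (type_act G \<gamma>) (type_act G \<delta>)" for \<gamma> \<delta>
  proof (rule extensionalityI)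
    show "type_act G (foldr gen_mult \<gamma> \<delta>) \<in> extensional (type_space G)" by (simp add: type_act_def)
  qed (simp_all add: compose_def type_act_mult)
  then have "type_act G \<in> hom Z2_free_product_4 (BijGroup (type_space G))"
    using Bij by (auto simp: hom_def BijGroup_def Z2_free_product_4_def)
  then show ?thesis
    unfolding group_action_def group_hom_def group_hom_axioms_def
    using group_Z2_free_product_4 group_BijGroup by blast
qed

text \<open>Reducing a word neither lengthens it nor changes where it leads, so walks are accounted for by
  group elements.\<close>
lemma normal_form:
  obtains \<gamma> where "distinct_adj \<gamma>" "length \<gamma> \<le> length w" "walk \<gamma> = walk w"
proof
  show "distinct_adj (foldr gen_mult w [])" by (intro distinct_adj_foldr_gen_mult) simp
  show "length (foldr gen_mult w []) \<le> length w"
    by (induction w) (auto intro: order_trans[OF length_gen_mult_le])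
  show "walk (foldr gen_mult w []) = walk w" by (rule ext) (simp add: walk_mult)
qed

text \<open>Dense holonomy, applied around a vertex \<open>x\<close> that realizes \<open>\<alpha>\<close> up to level \<open>k + m\<close>: a vertex of type
  \<open>\<tau>\<close> is reached from \<open>x\<close> by at most \<open>m\<close> letters, and the types of radius \<open>k\<close> at such vertices are
  determined by \<open>\<alpha>\<close>.\<close>
lemma orbit_meets_cylinder:
  assumes "dense_holonomy G" and \<alpha>: "\<alpha> \<in> type_space G" and k: "1 \<le> k" and \<tau>: "\<tau> \<in> types G k"
  obtains \<gamma> where "distinct_adj \<gamma>" "type_act G \<gamma> \<alpha> k = \<tau>"
proof -
  obtain m where m: "\<And>z. z \<in> verts G \<Longrightarrow> \<exists>x\<in>ball_verts G m z. rtype G k x = \<tau>"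
    using dense_holonomyE[OF assms(1) k \<tau>] by blast
  obtain x where x: "x \<in> verts G" "\<And>r. \<lbrakk>1 \<le> r; r \<le> k + m\<rbrakk> \<Longrightarrow> \<alpha> r = rtype G r x"
    using chain_vertex[OF \<alpha>, of "k + m"] by blast
  obtain w where w: "length w \<le> m" "rtype G k (walk w x) = \<tau>"
    using m[OF x(1)] unfolding ball_verts_eq_walks[OF x(1)] by blast
  obtain \<gamma> where \<gamma>: "distinct_adj \<gamma>" "length \<gamma> \<le> length w" "walk \<gamma> = walk w"
    using normal_form .
  have "\<alpha> (k + m) = rtype G (k + m) x" using x k by simp
  then have "type_act G \<gamma> \<alpha> k = rtype G k (walk \<gamma> x)"
    using type_act_eq[OF \<alpha> x(1)] k \<gamma> w by simp
  then show ?thesis using that \<gamma> w by simp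
qed

theorem minimal_type_act:
  assumes "dense_holonomy G"
  shows "minimal_action Z2_free_product_4 (type_topology G) (type_act G)"
  unfolding minimal_action_def topological_action_def
proof (intro conjI ballI)
  show "group_action Z2_free_product_4 (topspace (type_topology G)) (type_act G)"
    using group_action_type_act by simp
  show "homeomorphic_map (type_topology G) (type_topology G) (type_act G \<gamma>)"
    if "\<gamma> \<in> carrier Z2_free_product_4" for \<gamma>
    using that by (intro homeomorphic_type_act) (simp add: Z2_free_product_4_def)
  fix \<alpha> assume "\<alpha> \<in> topspace (type_topology G)"
  then have \<alpha>: "\<alpha> \<in> type_space G" by simp
  have "\<exists>\<gamma>. distinct_adj \<gamma> \<and> type_act G \<gamma> \<alpha> \<in> V" if V: "openin (type_topology G) V" "\<beta> \<in> V" for \<beta> V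
  proof -
    obtain k where k: "1 \<le> k" "\<forall>\<delta>\<in>type_space G. \<delta> k = \<beta> k \<longrightarrow> \<delta> \<in> V"
      by (rule openin_type_topologyE[OF V])
    have \<beta>: "\<beta> \<in> type_space G" using openin_subset[OF V(1)] V(2) by auto
    have "\<beta> k \<in> types G k" using \<beta> k(1) by (rule chain_in_types)
    then obtain \<gamma> where "distinct_adj \<gamma>" "type_act G \<gamma> \<alpha> k = \<beta> k"
      using orbit_meets_cylinder[OF assms \<alpha> k(1)] by blast
    then show ?thesis using k type_act_in_type_space[OF \<alpha>] by blast
  qed
  then have "type_space G \<subseteq> type_topology G closure_of (orbit Z2_free_product_4 (type_act G) \<alpha>)"
    unfolding closure_of_def by (auto simp: orbit_def Z2_free_product_4_def) metis
  then show "type_topology G closure_of (orbit Z2_free_product_4 (type_act G) \<alpha>) =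
      topspace (type_topology G)"
    using closure_of_subset_topspace[of "type_topology G"] by fastforce
qed

end

theorem proposition3p1:
  fixes G :: "('v, gen) colored_graph"
  assumes "four_colored_graph G"
    and "generic G"
    and "dense_holonomy G"
  shows "type_topology G homeomorphic_space top_of_set cantor_set \<and>
    minimal_action Z2_free_product_4 (type_topology G) (type_act G)"
proof -
  interpret four_colored G using assms(1) by unfold_locales
  show ?thesis
    using type_space_homeomorphic_cantor_set[OF assms(2,3)] minimal_type_act[OF assms(3)] ..
qed

end
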